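(* As formal power series in $z$, $$\sum_{n \geq 0}A^{\mathrm{maj},\mathrm{exc}}_n(q,t)\frac{z^n}{[n]_q!}=\frac{(1-tq)\exp_q(z)}{\exp_q(ztq)-tq\exp_q(z)}.$$
   Context: For $n\ge 1$ let $\mathfrak S_n$ be the symmetric group on $[n]=\{1,\dots,n\}$, and write $\sigma=\sigma_1\cdots\sigma_n$ with $\sigma_i=\sigma(i)$. Put $\mathrm{DES}(\sigma)=\{i\in[n-1]:\sigma_i>\sigma_{i+1}\}$, $\mathrm{maj}(\sigma)=\sum_{i\in \mathrm{DES}(\sigma)} i$, and $\mathrm{exc}(\sigma)=|\{i\in[n-1]:\sigma_i>i\}|$. Define $A_n^{\mathrm{maj},\mathrm{exc}}(q,t)=\sum_{\sigma\in\mathfrak S_n}q^{\mathrm{maj}(\sigma)}t^{\mathrm{exc}(\sigma)}$ for $n\ge1$ and $A_0^{\mathrm{maj},\mathrm{exc}}(q,t)=1$. Also $[n]_q=1+q+\cdots+q^{n-1}$, $[0]_q=0$, $[n]_q!=\prod_{j=1}^n[j]_q$, $[0]_q!=1$, and $\exp_q(z)=\sum_{n\ge0}\frac{z^n}{[n]_q!}$. *)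

theory Defs
  imports
    "HOL-Computational_Algebra.Computational_Algebra"
    "HOL-Combinatorics.Permutations"
begin

unbundle fps_syntax

section \<open>Permutation statistics\<close>

text \<open>
  A permutation in \<open>S\<^sub>n\<close> is a function \<open>\<sigma>\<close> with \<open>\<sigma> permutes {1..n}\<close>. Note that \<open>{1..<n}\<close> is
  the set \<open>[n-1]\<close>, and is empty for \<open>n = 0\<close>.
\<close>

definition DES :: "nat \<Rightarrow> (nat \<Rightarrow> nat) \<Rightarrow> nat set" where
  "DES n \<sigma> = {i \<in> {1..<n}. \<sigma> i > \<sigma> (i + 1)}"

definition maj :: "nat \<Rightarrow> (nat \<Rightarrow> nat) \<Rightarrow> nat" where
  "maj n \<sigma> = (\<Sum>i \<in> DES n \<sigma>. i)"

definition exc :: "nat \<Rightarrow> (nat \<Rightarrow> nat) \<Rightarrow> nat" where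
  "exc n \<sigma> = card {i \<in> {1..<n}. \<sigma> i > i}"

definition A_maj_exc :: "nat \<Rightarrow> 'a::comm_ring_1 \<Rightarrow> 'a \<Rightarrow> 'a" where
  "A_maj_exc n q t = (\<Sum>\<sigma> | \<sigma> permutes {1..n}. q ^ maj n \<sigma> * t ^ exc n \<sigma>)"

text \<open>The convention \<open>A\<^sub>0 = 1\<close> is already built into the sum.\<close>

lemma A_maj_exc_0: "A_maj_exc 0 q t = 1"
  by (simp add: A_maj_exc_def maj_def exc_def DES_def)


section \<open>\<open>q\<close>-analogues\<close>

definition q_int :: "'a::comm_ring_1 \<Rightarrow> nat \<Rightarrow> 'a" where
  "q_int q n = (\<Sum>i<n. q ^ i)"

definition q_fact :: "'a::comm_ring_1 \<Rightarrow> nat \<Rightarrow> 'a" where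
  "q_fact q n = (\<Prod>j = 1..n. q_int q j)"

definition exp_q :: "'a::field \<Rightarrow> 'a fps" where
  "exp_q q = Abs_fps (\<lambda>n. 1 / q_fact q n)"


section \<open>The indeterminates\<close>

text \<open>
  The coefficients of the power series in \<open>z\<close> live in the field of rational functions
  \<open>\<rat>(q,t)\<close>, realised as the fraction field of \<open>\<int>[q][t]\<close>: the inner polynomial variable is \<open>q\<close>
  and the outer one is \<open>t\<close>.
\<close>

type_synonym ratfun_qt = "int poly poly fract"

definition var_q :: ratfun_qt where
  "var_q = to_fract [:[:0, 1:]:]"

definition var_t :: ratfun_qt where
  "var_t = to_fract [:0, 1:]"

text \<open>
  All divisions in the identity are genuine: the \<open>q\<close>-factorials are nonzero, and the power series
  in the denominator has the nonzero constant term \<open>1 - tq\<close>.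
\<close>

lemma to_fract_power: "to_fract (x ^ n) = to_fract x ^ n"
  by (induction n) simp_all

lemma to_fract_sum: "to_fract (sum f A) = (\<Sum>x\<in>A. to_fract (f x))"
  by (induction A rule: infinite_finite_induct) simp_all

lemma q_int_var_q_nonzero:
  assumes "n > 0"
  shows "q_int var_q n \<noteq> 0"
proof -
  define p :: "int poly poly" where "p = (\<Sum>i<n. [:[:0, 1:]:] ^ i)"
  have "poly (poly p 0) 1 = (\<Sum>i<n. 1)"
    by (simp add: p_def poly_sum poly_power)
  with assms have "p \<noteq> 0" by auto
  moreover have "q_int var_q n = to_fract p"
    by (simp add: q_int_def var_q_def p_def to_fract_sum to_fract_power)
  ultimately show ?thesis by simp
qed

lemma q_fact_var_q_nonzero: "q_fact var_q n \<noteq> 0"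
  by (simp add: q_fact_def q_int_var_q_nonzero)

lemma denominator_nth_0_nonzero:
  "(exp_q var_q oo (fps_const (var_t * var_q) * fps_X)
     - fps_const (var_t * var_q) * exp_q var_q) $ 0 \<noteq> 0"
proof -
  have "var_t * var_q = to_fract [:0, [:0, 1:]:]"
    by (simp add: var_t_def var_q_def flip: to_fract_mult)
  also have "\<dots> \<noteq> to_fract 1"
    by (simp only: to_fract_eq_iff) (simp add: one_pCons)
  finally show ?thesis
    by (simp add: exp_q_def q_fact_def)
qed

end

theory Submission
  imports Defs
begin

text \<open>
  Write \<open>T = t q\<close>. For a permutation \<open>\<sigma>\<close> let \<open>D(\<sigma>)\<close> be the descent set of \<open>\<sigma>\<^sub>1\<dots>\<sigma>\<^sub>n\<close> after all
  excedance letters (those with \<open>\<sigma>\<^sub>i > i\<close>) have been declared smaller than all the others.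
  Summation by parts shows \<open>\<Sum>D(\<sigma>) = maj \<sigma> - exc \<sigma>\<close>, so
  \<open>A\<^sub>n(q, t) = \<Sum>\<^sub>\<sigma> T\<^bsup>exc \<sigma>\<^esup> q\<^bsup>\<Sum>D(\<sigma>)\<^esup>\<close> (\<open>sum_excedance_descents\<close>). Up to the factor
  \<open>(1 - q)\<dots>(1 - q\<^sup>n)\<close>, the power \<open>q\<^bsup>\<Sum>D(\<sigma>)\<^esup>\<close> is the sum of \<open>q\<^bsup>s\<^sub>1 + \<dots> + s\<^sub>n\<^esup>\<close> over all sequences
  \<open>s\<^sub>1 \<ge> \<dots> \<ge> s\<^sub>n \<ge> 0\<close> that decrease strictly at the places in \<open>D(\<sigma>)\<close>. It therefore suffices
  to enumerate the pairs \<open>(\<sigma>, s)\<close>, first under the bound \<open>s\<^sub>1 < M\<close> (\<open>sum_descending\<close>).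

  Encode the place \<open>i\<close> by the letter \<open>c\<^sub>i = 2(M - 1 - s\<^sub>i)\<close> if \<open>\<sigma>\<^sub>i > i\<close>, and by
  \<open>c\<^sub>i = 2(M - 1 - s\<^sub>i) + 1\<close> otherwise. Then \<open>c\<close> increases weakly, and \<open>\<sigma>\<close> increases wherever \<open>c\<close> is
  constant. Putting \<open>c\<^sub>i\<close> at the place \<open>\<sigma>\<^sub>i\<close> gives a word \<open>w\<close> from which \<open>c\<close> is recovered by sorting
  and \<open>\<sigma>\<close> by stable sorting, so that the pairs \<open>(\<sigma>, c)\<close> correspond to arbitrary words. The
  requirement that \<open>c\<^sub>i\<close> is even exactly if \<open>\<sigma>\<^sub>i > i\<close> becomes a condition on \<open>w\<close>
  (\<open>excedance_parity_iff\<close>): an even letter \<open>w\<^sub>j\<close> satisfies \<open>w\<^sub>j \<le> c\<^sub>j\<close>, an odd one \<open>c\<^sub>j \<le> w\<^sub>j\<close>, and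
  no even letter \<open>e\<close> stands in \<open>w\<close> at the first of the places where \<open>c\<close> is \<open>e\<close>.

  The last part of the condition costs an explicit product (\<open>headless_words_series\<close>). The other
  part is local, in that every place contributes a weight depending only on \<open>(w\<^sub>j, c\<^sub>j)\<close>, and
  MacMahon's master theorem says that such a sum over all words is a rational function. The form
  used here removes one letter at a time (\<open>word_series_eliminate\<close>). The weights arising above
  belong to a family of matrices with one parameter that is closed under this removal, which
  makes the sum computable (\<open>word_series_threshold\<close>). With
  \<open>H\<^sub>M(z) = \<Prod>s<M. 1 / (1 - q\<^sup>s z)\<close>, the generating function \<open>G\<^sub>M\<close> of the pairs \<open>(\<sigma>, s)\<close> satisfies
  \<open>G\<^sub>M(z) (H\<^sub>M(T z) - T H\<^sub>M(z)) = (1 - T) H\<^sub>M(z)\<close> (\<open>bounded_identity\<close>).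

  Finally \<open>M\<close> tends to infinity. All coefficients involved are eventually polynomials in \<open>q\<^sup>M\<close>, and
  since the powers of \<open>q\<close> are distinct, two such polynomials that agree for all large \<open>M\<close> have the
  same constant term. The constant terms form the asserted identity with \<open>z / (1 - q)\<close> in place
  of \<open>z\<close>.
\<close>

section \<open>Words, and sums over all lengths\<close>

definition words :: "nat set \<Rightarrow> nat \<Rightarrow> nat list set" where
  "words A n = {w. set w \<subseteq> A \<and> length w = n}"

lemma finite_words: "finite A \<Longrightarrow> finite (words A n)"
  by (simp add: words_def finite_lists_length_eq)

lemma words_0 [simp]: "words A 0 = {[]}"
  by (auto simp: words_def)

lemma sum_words_Suc:
  assumes "finite A"
  shows "(\<Sum>w\<in>words A (Suc n). f w) = (\<Sum>x\<in>A. \<Sum>w\<in>words A n. f (x # w))"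
proof -
  have "words A (Suc n) = (\<lambda>(x, w). x # w) ` (A \<times> words A n)"
    by (auto simp: words_def length_Suc_conv image_iff)
  moreover have "inj_on (\<lambda>(x, w). x # w) (A \<times> words A n)"
    by (auto simp: inj_on_def)
  ultimately show ?thesis
    by (simp add: sum.reindex sum.cartesian_product case_prod_unfold)
qed

lemma sum_words_append:
  assumes "finite A"
  shows "(\<Sum>w\<in>words A (n + m). f w) = (\<Sum>u\<in>words A n. \<Sum>v\<in>words A m. f (u @ v))"
proof (induction n arbitrary: f)
  case (Suc n)
  show ?case
    using assms by (simp add: sum_words_Suc Suc)
qed simp

text \<open>
  The series \<open>\<Sum>l. z\<^sup>l f\<^sub>l\<close>, where \<open>z\<close> is the variable of the power series \<open>f\<^sub>l\<close> themselves. The factor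
  \<open>z\<^sup>l\<close> makes the infinite sum meaningful without any assumption on the \<open>f\<^sub>l\<close>.
\<close>

definition fps_total :: "(nat \<Rightarrow> 'a::comm_ring_1 fps) \<Rightarrow> 'a fps" where
  "fps_total f = Abs_fps (\<lambda>n. \<Sum>l\<le>n. f l $ (n - l))"

lemma fps_total_Suc: "fps_total f = f 0 + fps_X * fps_total (\<lambda>n. f (Suc n))"
proof (rule fps_ext)
  fix n show "fps_total f $ n = (f 0 + fps_X * fps_total (\<lambda>n. f (Suc n))) $ n"
    by (cases n) (simp_all add: fps_total_def sum.atMost_Suc_shift del: sum.atMost_Suc)
qed

lemma fps_total_mult_left: "fps_total (\<lambda>n. c * f n) = c * fps_total f"
proof (rule fps_ext)
  fix n
  have "fps_total (\<lambda>n. c * f n) $ n = (\<Sum>l\<le>n. \<Sum>i\<le>n - l. c $ i * f l $ (n - l - i))"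
    by (simp add: fps_total_def fps_mult_nth atLeast0AtMost)
  also have "\<dots> = (\<Sum>(l, i)\<in>(SIGMA l:{..n}. {..n - l}). c $ i * f l $ (n - l - i))"
    by (simp add: sum.Sigma)
  also have "\<dots> = (\<Sum>(i, l)\<in>(SIGMA i:{..n}. {..n - i}). c $ i * f l $ (n - i - l))"
    by (rule sum.reindex_bij_witness[of _ "\<lambda>(i, l). (l, i)" "\<lambda>(i, l). (l, i)"])
      (auto simp: add.commute)
  also have "\<dots> = (c * fps_total f) $ n"
    by (simp add: fps_total_def fps_mult_nth atLeast0AtMost sum.Sigma[symmetric] sum_distrib_left)
  finally show "fps_total (\<lambda>n. c * f n) $ n = (c * fps_total f) $ n" .
qed

lemma fps_total_add: "fps_total (\<lambda>n. f n + g n) = fps_total f + fps_total g"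
  by (rule fps_ext) (simp add: fps_total_def sum.distrib)

lemma fps_total_sum: "fps_total (\<lambda>n. \<Sum>x\<in>A. f x n) = (\<Sum>x\<in>A. fps_total (f x))"
proof (cases "finite A")
  case True
  then show ?thesis
  proof (induction A)
    case empty
    then show ?case by (simp add: fps_total_def fps_zero_def[symmetric])
  next
    case (insert x A)
    then show ?case by (simp add: fps_total_add)
  qed
qed (simp add: fps_total_def fps_zero_def[symmetric])

lemma fps_total_convolution:
  "fps_total (\<lambda>n. \<Sum>l\<le>n. f l (n - l)) = fps_total (\<lambda>l. fps_total (f l))"
proof (rule fps_ext)
  fix n
  have "fps_total (\<lambda>n. \<Sum>l\<le>n. f l (n - l)) $ n
      = (\<Sum>N\<le>n. \<Sum>l\<le>N. f l (N - l) $ (n - N))"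
    by (simp add: fps_total_def fps_sum_nth)
  also have "\<dots> = (\<Sum>(N, l)\<in>(SIGMA N:{..n}. {..N}). f l (N - l) $ (n - N))"
    by (simp add: sum.Sigma)
  also have "\<dots> = (\<Sum>(l, m)\<in>(SIGMA l:{..n}. {..n - l}). f l m $ (n - l - m))"
    by (rule sum.reindex_bij_witness[of _ "\<lambda>(l, m). (l + m, l)" "\<lambda>(N, l). (l, N - l)"]) auto
  also have "\<dots> = fps_total (\<lambda>l. fps_total (f l)) $ n"
    by (simp add: fps_total_def sum.Sigma[symmetric])
  finally show "fps_total (\<lambda>n. \<Sum>l\<le>n. f l (n - l)) $ n = fps_total (\<lambda>l. fps_total (f l)) $ n" .
qed

section \<open>MacMahon's master theorem by elimination of the largest letter\<close>

definition word_weight :: "(nat \<Rightarrow> nat \<Rightarrow> 'a::comm_ring_1) \<Rightarrow> nat list \<Rightarrow> 'a" where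
  "word_weight b w = prod_list (map2 b w (sort w))"

text \<open>
  By MacMahon's master theorem this is \<open>1 / det (I - z b)\<close>; the determinant itself never occurs
  below, because one letter after another is eliminated instead.
\<close>

definition word_series :: "nat set \<Rightarrow> (nat \<Rightarrow> nat \<Rightarrow> 'a::comm_ring_1 fps) \<Rightarrow> 'a fps" where
  "word_series A b = fps_total (\<lambda>n. \<Sum>w\<in>words A n. word_weight b w)"

lemma word_weight_cong:
  assumes "\<And>i j. i \<in> set w \<Longrightarrow> j \<in> set w \<Longrightarrow> b i j = b' i j"
  shows "word_weight b w = word_weight b' w"
  unfolding word_weight_def
  by (intro arg_cong[where f = prod_list] map_cong) (auto dest: in_set_zipE intro!: assms elim!: in_set_zipE)

lemma word_series_cong:
  assumes "\<And>i j. i \<in> A \<Longrightarrow> j \<in> A \<Longrightarrow> b i j = b' i j"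
  shows "word_series A b = word_series A b'"
proof -
  have "(\<Sum>w\<in>words A n. word_weight b w) = (\<Sum>w\<in>words A n. word_weight b' w)" for n
    by (intro sum.cong word_weight_cong assms) (auto simp: words_def)
  then show ?thesis by (simp add: word_series_def)
qed

text \<open>
  Sorting a word over \<open>{..r}\<close> moves all letters \<open>r\<close> into a last block, so the part \<open>v\<close> of the word
  standing in that block pays \<open>b x r\<close> for every letter \<open>x\<close>. If \<open>k\<close> letters of \<open>v\<close> differ from \<open>r\<close>,
  they are separated by \<open>k + 1\<close> arbitrary runs of \<open>r\<close>, each contributing the geometric series
  \<open>\<gamma>\<close>. The weight \<open>g\<close> stands for the rest of the word; it sees the remaining letters of \<open>v\<close> only
  through the sorted rearrangement of the whole word, hence as a multiset.
\<close>

lemma last_block_series: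
  fixes b :: "nat \<Rightarrow> nat \<Rightarrow> 'a::field fps" and g :: "nat multiset \<Rightarrow> 'a fps"
  assumes \<gamma>: "\<gamma> * (1 - fps_X * b r r) = 1"
  shows "fps_total (\<lambda>m. \<Sum>v\<in>words {..r} m. if length (filter (\<lambda>x. x \<noteq> r) v) = k
             then prod_list (map (\<lambda>x. b x r) v) * g (mset (filter (\<lambda>x. x \<noteq> r) v)) else 0)
       = fps_X ^ k * \<gamma> ^ Suc k *
           (\<Sum>p\<in>words {..<r} k. prod_list (map (\<lambda>x. b x r) p) * g (mset p))"
    (is "?V k g = _")
proof (induction k arbitrary: g)
  have fin: "finite {..r}" "finite {..<r}" and ins: "{..r} = insert r {..<r}"
    by auto
  \<comment> \<open>The first letter of \<open>v\<close> is \<open>r\<close>, or it is another letter and lowers \<open>k\<close>.\<close>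
  { fix k g
    have "?V k g = (if k = 0 then g {#} else 0) + fps_X * fps_total (\<lambda>m.
        b r r * (\<Sum>v\<in>words {..r} m. if length (filter (\<lambda>x. x \<noteq> r) v) = k
             then prod_list (map (\<lambda>x. b x r) v) * g (mset (filter (\<lambda>x. x \<noteq> r) v)) else 0)
       + (\<Sum>i<r. b i r * (\<Sum>v\<in>words {..r} m. if Suc (length (filter (\<lambda>x. x \<noteq> r) v)) = k
             then prod_list (map (\<lambda>x. b x r) v) * g (add_mset i (mset (filter (\<lambda>x. x \<noteq> r) v)))
             else 0)))"
      apply (subst fps_total_Suc)
      apply (simp only: sum_words_Suc[OF fin(1)])
      apply (simp only: ins)
      apply (simp add: sum_distrib_left if_distrib mult.assoc cong: if_cong)
      done
    then have "?V k g = (if k = 0 then g {#} else 0) + fps_X * (b r r * ?V k g +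
       (\<Sum>i<r. b i r * fps_total (\<lambda>m. \<Sum>v\<in>words {..r} m. if Suc (length (filter (\<lambda>x. x \<noteq> r) v)) = k
             then prod_list (map (\<lambda>x. b x r) v) * g (add_mset i (mset (filter (\<lambda>x. x \<noteq> r) v)))
             else 0)))"
      by (simp only: fps_total_add fps_total_sum fps_total_mult_left)
  } note step = this
  \<comment> \<open>The equation for \<open>?V k g\<close> is linear with coefficient \<open>1 - z b r r\<close>.\<close>
  have solve: "V = \<gamma> * (c + fps_X * s)" if "V = c + fps_X * (b r r * V + s)" for V c s
  proof -
    have "V * (1 - fps_X * b r r) = c + fps_X * s"
      using that by (simp add: algebra_simps)
    then have "V * (\<gamma> * (1 - fps_X * b r r)) = \<gamma> * (c + fps_X * s)"
      by (metis mult.left_commute)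
    with \<gamma> show ?thesis by simp
  qed
  {
    case 0
    show ?case
      using solve[OF step[of 0 g]] by (simp add: fps_total_def fps_zero_def[symmetric])
  next
    case (Suc k)
    show ?case
      using solve[OF step[of "Suc k" g]]
      by (simp add: Suc[of "\<lambda>M. g (add_mset i M)" for i] sum_words_Suc[OF fin(2)] sum_distrib_left mult_ac)
  }
qed

text \<open>
  Each of the letters \<open>r\<close> in \<open>u\<close> is replaced by the next letter of \<open>p\<close>, which turns \<open>u\<close> into a word
  \<open>w\<close> over \<open>{..<r}\<close>. Conversely every place of \<open>w\<close> either kept its letter \<open>i\<close>, or held \<open>r\<close> and gave
  \<open>i\<close> to \<open>p\<close>; these two cases are the summands on the right. The column \<open>C M j\<close> may depend on
  the content \<open>M\<close> because the replacement does not change it, and \<open>g\<close> is carried along only to make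
  the induction on the length possible.
\<close>

lemma substitution_in_words:
  fixes b :: "nat \<Rightarrow> nat \<Rightarrow> 'a::comm_ring_1" and g :: "nat multiset \<Rightarrow> 'a"
  shows "(\<Sum>u\<in>words {..r} l. \<theta> ^ length (filter (\<lambda>x. x = r) u) *
           (\<Sum>p\<in>words {..<r} (length (filter (\<lambda>x. x = r) u)). prod_list (map (\<lambda>x. b x r) p) *
             (let M = mset (filter (\<lambda>x. x \<noteq> r) u) + mset p in
               g M * (\<Prod>j<l. b (u ! j) (C M j)))))
       = (\<Sum>w\<in>words {..<r} l. g (mset w) *
           (\<Prod>j<l. b (w ! j) (C (mset w) j) + \<theta> * b r (C (mset w) j) * b (w ! j) r))"
proof (induction l arbitrary: g C)
  case (Suc l)
  have fin: "finite {..r}" "finite {..<r}" and ins: "{..r} = insert r {..<r}"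
    by auto
  let ?R = "\<lambda>i y. \<Sum>w\<in>words {..<r} l. g (add_mset i (mset w)) * b y (C (add_mset i (mset w)) 0) *
           (\<Prod>j<l. b (w ! j) (C (add_mset i (mset w)) (Suc j)) +
              \<theta> * b r (C (add_mset i (mset w)) (Suc j)) * b (w ! j) r)"
  let ?lhs = "\<lambda>l. \<Sum>u\<in>words {..r} l. \<theta> ^ length (filter (\<lambda>x. x = r) u) *
           (\<Sum>p\<in>words {..<r} (length (filter (\<lambda>x. x = r) u)). prod_list (map (\<lambda>x. b x r) p) *
             (let M = mset (filter (\<lambda>x. x \<noteq> r) u) + mset p in
               g M * (\<Prod>j<l. b (u ! j) (C M j))))"
  have split_last: "(\<Sum>x\<le>r. f x) = f r + (\<Sum>x<r. f x)" for f :: "nat \<Rightarrow> 'a"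
    by (subst ins) simp
  have IH: "(\<Sum>u\<in>words {..r} l. \<theta> ^ length (filter (\<lambda>x. x = r) u) *
           (\<Sum>p\<in>words {..<r} (length (filter (\<lambda>x. x = r) u)). prod_list (map (\<lambda>x. b x r) p) *
             (let M = add_mset i (mset (filter (\<lambda>x. x \<noteq> r) u) + mset p) in
               g M * b y (C M 0) * (\<Prod>j<l. b (u ! j) (C M (Suc j))))))
       = (\<Sum>w\<in>words {..<r} l. g (add_mset i (mset w)) * b y (C (add_mset i (mset w)) 0) *
           (\<Prod>j<l. b (w ! j) (C (add_mset i (mset w)) (Suc j)) +
              \<theta> * b r (C (add_mset i (mset w)) (Suc j)) * b (w ! j) r))" for i y
    using Suc[of "\<lambda>M. g (add_mset i M) * b y (C (add_mset i M) 0)"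
        "\<lambda>M j. C (add_mset i M) (Suc j)"]
    by (simp add: Let_def)
  \<comment> \<open>The first place of \<open>u\<close> keeps its letter \<open>i\<close>, or it holds \<open>r\<close> and the first letter of \<open>p\<close> is \<open>i\<close>.\<close>
  have first: "(\<Sum>p\<in>words {..<r} (length (filter (\<lambda>x. x = r) (i # u))). prod_list (map (\<lambda>x. b x r) p) *
             (let M = mset (filter (\<lambda>x. x \<noteq> r) (i # u)) + mset p in
               g M * (\<Prod>j<Suc l. b ((i # u) ! j) (C M j)))) =
       (\<Sum>p\<in>words {..<r} (length (filter (\<lambda>x. x = r) u)). prod_list (map (\<lambda>x. b x r) p) *
             (let M = add_mset i (mset (filter (\<lambda>x. x \<noteq> r) u) + mset p) in
               g M * b i (C M 0) * (\<Prod>j<l. b (u ! j) (C M (Suc j)))))" if "i < r" for i u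
    using that by (simp add: Let_def prod.lessThan_Suc_shift mult.assoc del: prod.lessThan_Suc)
  have last: "(\<Sum>p\<in>words {..<r} (length (filter (\<lambda>x. x = r) (r # u))). prod_list (map (\<lambda>x. b x r) p) *
             (let M = mset (filter (\<lambda>x. x \<noteq> r) (r # u)) + mset p in
               g M * (\<Prod>j<Suc l. b ((r # u) ! j) (C M j)))) =
       (\<Sum>i<r. b i r * (\<Sum>p\<in>words {..<r} (length (filter (\<lambda>x. x = r) u)). prod_list (map (\<lambda>x. b x r) p) *
             (let M = add_mset i (mset (filter (\<lambda>x. x \<noteq> r) u) + mset p) in
               g M * b r (C M 0) * (\<Prod>j<l. b (u ! j) (C M (Suc j))))))" for u
    by (simp add: sum_words_Suc sum_distrib_left Let_def prod.lessThan_Suc_shift mult.assoc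
          del: prod.lessThan_Suc)
  have "(\<Sum>u\<in>words {..r} (Suc l). \<theta> ^ length (filter (\<lambda>x. x = r) u) *
           (\<Sum>p\<in>words {..<r} (length (filter (\<lambda>x. x = r) u)). prod_list (map (\<lambda>x. b x r) p) *
             (let M = mset (filter (\<lambda>x. x \<noteq> r) u) + mset p in
               g M * (\<Prod>j<Suc l. b (u ! j) (C M j)))))
      = (\<Sum>u\<in>words {..r} l. \<theta> ^ Suc (length (filter (\<lambda>x. x = r) u)) *
         (\<Sum>i<r. b i r * (\<Sum>p\<in>words {..<r} (length (filter (\<lambda>x. x = r) u)). prod_list (map (\<lambda>x. b x r) p) *
             (let M = add_mset i (mset (filter (\<lambda>x. x \<noteq> r) u) + mset p) in
               g M * b r (C M 0) * (\<Prod>j<l. b (u ! j) (C M (Suc j)))))))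
       + (\<Sum>i<r. \<Sum>u\<in>words {..r} l. \<theta> ^ length (filter (\<lambda>x. x = r) u) *
         (\<Sum>p\<in>words {..<r} (length (filter (\<lambda>x. x = r) u)). prod_list (map (\<lambda>x. b x r) p) *
             (let M = add_mset i (mset (filter (\<lambda>x. x \<noteq> r) u) + mset p) in
               g M * b i (C M 0) * (\<Prod>j<l. b (u ! j) (C M (Suc j))))))"
    unfolding sum_words_Suc[OF fin(1)] split_last
    apply (rule arg_cong2[where f = "(+)"])
    subgoal by (simp only: last) simp
    subgoal by (rule sum.cong[OF refl]) (simp only: first lessThan_iff, simp)
    done
  also have "(\<Sum>u\<in>words {..r} l. \<theta> ^ Suc (length (filter (\<lambda>x. x = r) u)) *
         (\<Sum>i<r. b i r * (\<Sum>p\<in>words {..<r} (length (filter (\<lambda>x. x = r) u)). prod_list (map (\<lambda>x. b x r) p) *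
             (let M = add_mset i (mset (filter (\<lambda>x. x \<noteq> r) u) + mset p) in
               g M * b r (C M 0) * (\<Prod>j<l. b (u ! j) (C M (Suc j)))))))
     = (\<Sum>i<r. \<theta> * b i r * (\<Sum>u\<in>words {..r} l. \<theta> ^ (length (filter (\<lambda>x. x = r) u)) *
         (\<Sum>p\<in>words {..<r} (length (filter (\<lambda>x. x = r) u)). prod_list (map (\<lambda>x. b x r) p) *
             (let M = add_mset i (mset (filter (\<lambda>x. x \<noteq> r) u) + mset p) in
               g M * b r (C M 0) * (\<Prod>j<l. b (u ! j) (C M (Suc j)))))))"
    unfolding sum_distrib_left by (subst sum.swap) (simp add: mult_ac)
  finally have "?lhs (Suc l) = (\<Sum>i<r. \<theta> * b i r * ?R i r) + (\<Sum>i<r. ?R i i)"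
    by (simp only: IH)
  also have "\<dots> = (\<Sum>i<r. \<theta> * b i r * ?R i r + ?R i i)"
    by (rule sum.distrib[symmetric])
  also have "\<dots> = (\<Sum>i<r. \<Sum>w\<in>words {..<r} l. g (mset (i # w)) *
           (\<Prod>j<Suc l. b ((i # w) ! j) (C (mset (i # w)) j) +
              \<theta> * b r (C (mset (i # w)) j) * b ((i # w) ! j) r))"
    unfolding sum_distrib_left sum.distrib[symmetric]
    by (intro sum.cong refl, simp only: prod.lessThan_Suc_shift mset.simps nth_Cons_0 nth_Cons_Suc)
       (simp only: distrib_left distrib_right mult_ac add_ac)
  finally show ?case
    by (simp only: sum_words_Suc[OF fin(2)])
qed (simp add: Let_def)

lemma sort_last_block:
  assumes "set w \<subseteq> {..r::nat}"
  shows "sort w = sorted_list_of_multiset (mset (filter (\<lambda>x. x \<noteq> r) w)) @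
           replicate (length (filter (\<lambda>x. x = r) w)) r"
proof (rule properties_for_sort)
  have "mset (filter (\<lambda>x. x = r) w) = replicate_mset (length (filter (\<lambda>x. x = r) w)) r"
    by (induction w) auto
  then show "mset (sorted_list_of_multiset (mset (filter (\<lambda>x. x \<noteq> r) w)) @
           replicate (length (filter (\<lambda>x. x = r) w)) r) = mset w"
    using multiset_partition[of "mset w" "\<lambda>x. x = r"] by (simp add: add.commute)
  show "sorted (sorted_list_of_multiset (mset (filter (\<lambda>x. x \<noteq> r) w)) @
           replicate (length (filter (\<lambda>x. x = r) w)) r)"
    using assms by (auto simp: sorted_append sorted_sorted_list_of_multiset)
qed

lemma prod_list_map2_nth:
  "length xs = length ys \<Longrightarrow>
     prod_list (map2 f xs ys) = (\<Prod>j<length xs. f (xs ! j) (ys ! j) :: 'a::comm_monoid_mult)"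
  by (induction xs ys rule: list_induct2)
     (simp_all add: prod.lessThan_Suc_shift del: prod.lessThan_Suc)

lemma prod_list_map2_replicate:
  "length xs = n \<Longrightarrow> prod_list (map2 f xs (replicate n y)) = prod_list (map (\<lambda>x. f x y) xs)"
  by (induction xs arbitrary: n) auto

lemma prod_list_map2_append_replicate:
  "length u = length c \<Longrightarrow> prod_list (map2 b (u @ v) (c @ replicate (length v) r)) =
     prod_list (map2 b u c) * prod_list (map (\<lambda>x. b x r) v)"
  by (simp add: prod_list_map2_replicate)

lemma word_weight_last_block:
  assumes "u \<in> words {..r} l" "v \<in> words {..r} m"
    and "length (filter (\<lambda>x. x \<noteq> r) v) = length (filter (\<lambda>x. x = r) u)"
  shows "word_weight b (u @ v) = prod_list (map (\<lambda>x. b x r) v) *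
     (\<Prod>j<l. b (u ! j) (sorted_list_of_multiset (mset (filter (\<lambda>x. x \<noteq> r) u)
         + mset (filter (\<lambda>x. x \<noteq> r) v)) ! j))"
proof -
  let ?c = "sorted_list_of_multiset (mset (filter (\<lambda>x. x \<noteq> r) u) + mset (filter (\<lambda>x. x \<noteq> r) v))"
  have len: "length u = l" "length v = m"
    using assms by (auto simp: words_def)
  have part: "length (filter (\<lambda>x. x = r) w) + length (filter (\<lambda>x. x \<noteq> r) w) = length w" for w
    by (rule sum_length_filter_compl)
  have "length ?c = length (filter (\<lambda>x. x \<noteq> r) u) + length (filter (\<lambda>x. x \<noteq> r) v)"
    by (metis size_mset mset_sorted_list_of_multiset size_union)
  then have c: "length ?c = length u"
    using assms(3) part[of u] by simp
  have m: "length (filter (\<lambda>x. x = r) (u @ v)) = length v"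
    using assms(3) part[of v] by simp
  have "sort (u @ v) = ?c @ replicate (length v) r"
    using assms by (subst sort_last_block[where r = r]) (auto simp: words_def m[simplified])
  then have "word_weight b (u @ v) = prod_list (map2 b u ?c) * prod_list (map (\<lambda>x. b x r) v)"
    unfolding word_weight_def by (simp only: prod_list_map2_append_replicate[OF c[symmetric]])
  also have "prod_list (map2 b u ?c) = (\<Prod>j<l. b (u ! j) (?c ! j))"
    using c len by (simp only: prod_list_map2_nth)
  finally show ?thesis
    by (simp only: mult.commute)
qed

text \<open>
  The new matrix \<open>b'\<close> counts the passages from \<open>i\<close> to \<open>j\<close> that go either directly or through \<open>r\<close>,
  where they may stay arbitrarily long. With \<open>\<gamma>\<close> the inverse of the pivot \<open>1 - z b r r\<close>, the matrix
  \<open>I - z b'\<close> is the Schur complement of that pivot in \<open>I - z b\<close>.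
\<close>

lemma word_series_eliminate:
  fixes b :: "nat \<Rightarrow> nat \<Rightarrow> 'a::field fps"
  assumes \<gamma>: "\<gamma> * (1 - fps_X * b r r) = 1"
  shows "word_series {..r} b =
           \<gamma> * word_series {..<r} (\<lambda>i j. b i j + fps_X * \<gamma> * b r j * b i r)"
proof -
  define G where "G u M = (\<Prod>j<length u. b (u ! j)
      (sorted_list_of_multiset (mset (filter (\<lambda>x. x \<noteq> r) u) + M) ! j))" for u M
  \<comment> \<open>A word is cut before its last block, whose length is the number of letters \<open>r\<close>; so the block
      contains as many other letters as there are letters \<open>r\<close> in front of it.\<close>
  have split: "(\<Sum>w\<in>words {..r} n. word_weight b w) = (\<Sum>l\<le>n. \<Sum>u\<in>words {..r} l. \<Sum>v\<in>words {..r} (n - l).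
      if length (filter (\<lambda>x. x \<noteq> r) v) = length (filter (\<lambda>x. x = r) u)
      then prod_list (map (\<lambda>x. b x r) v) * G u (mset (filter (\<lambda>x. x \<noteq> r) v)) else 0)" for n
  proof -
    have "word_weight b w = (\<Sum>l\<le>n. if length (filter (\<lambda>x. x \<noteq> r) w) = l then word_weight b w else 0)"
      if "w \<in> words {..r} n" for w
      using that by (auto simp: words_def)
    then have "(\<Sum>w\<in>words {..r} n. word_weight b w) =
        (\<Sum>w\<in>words {..r} n. \<Sum>l\<le>n. if length (filter (\<lambda>x. x \<noteq> r) w) = l then word_weight b w else 0)"
      by (rule sum.cong[OF refl])
    also have "\<dots> = (\<Sum>l\<le>n. \<Sum>w\<in>words {..r} (l + (n - l)).
        if length (filter (\<lambda>x. x \<noteq> r) w) = l then word_weight b w else 0)"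
      by (subst sum.swap) (intro sum.cong refl, auto)
    also have "\<dots> = (\<Sum>l\<le>n. \<Sum>u\<in>words {..r} l. \<Sum>v\<in>words {..r} (n - l).
        if length (filter (\<lambda>x. x \<noteq> r) (u @ v)) = l then word_weight b (u @ v) else 0)"
      by (simp only: sum_words_append[OF finite_atMost])
    also have "\<dots> = (\<Sum>l\<le>n. \<Sum>u\<in>words {..r} l. \<Sum>v\<in>words {..r} (n - l).
      if length (filter (\<lambda>x. x \<noteq> r) v) = length (filter (\<lambda>x. x = r) u)
      then prod_list (map (\<lambda>x. b x r) v) * G u (mset (filter (\<lambda>x. x \<noteq> r) v)) else 0)"
    proof (intro sum.cong refl)
      fix l u v assume uv: "u \<in> words {..r} l" "v \<in> words {..r} (n - l)"
      have "length (filter (\<lambda>x. x = r) u) + length (filter (\<lambda>x. x \<noteq> r) u) = l"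
        using uv by (simp add: sum_length_filter_compl words_def)
      then have "length (filter (\<lambda>x. x \<noteq> r) (u @ v)) = l \<longleftrightarrow>
          length (filter (\<lambda>x. x \<noteq> r) v) = length (filter (\<lambda>x. x = r) u)"
        by auto
      moreover have "length u = l" using uv by (simp add: words_def)
      ultimately show "(if length (filter (\<lambda>x. x \<noteq> r) (u @ v)) = l then word_weight b (u @ v) else 0) =
          (if length (filter (\<lambda>x. x \<noteq> r) v) = length (filter (\<lambda>x. x = r) u)
           then prod_list (map (\<lambda>x. b x r) v) * G u (mset (filter (\<lambda>x. x \<noteq> r) v)) else 0)"
        using uv by (simp add: word_weight_last_block G_def)
    qed
    finally show ?thesis .
  qed
  have "word_series {..r} b = fps_total (\<lambda>l. fps_total (\<lambda>m. \<Sum>u\<in>words {..r} l. \<Sum>v\<in>words {..r} m.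
      if length (filter (\<lambda>x. x \<noteq> r) v) = length (filter (\<lambda>x. x = r) u)
      then prod_list (map (\<lambda>x. b x r) v) * G u (mset (filter (\<lambda>x. x \<noteq> r) v)) else 0))"
    unfolding word_series_def split by (rule fps_total_convolution)
  also have "\<dots> = fps_total (\<lambda>l. \<Sum>u\<in>words {..r} l.
      fps_X ^ length (filter (\<lambda>x. x = r) u) * \<gamma> ^ Suc (length (filter (\<lambda>x. x = r) u)) *
        (\<Sum>p\<in>words {..<r} (length (filter (\<lambda>x. x = r) u)). prod_list (map (\<lambda>x. b x r) p) * G u (mset p)))"
    by (simp only: fps_total_sum last_block_series[where b = b and r = r and \<gamma> = \<gamma>, OF \<gamma>])
  also have "\<dots> = fps_total (\<lambda>l. \<gamma> * (\<Sum>u\<in>words {..r} l.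
      (fps_X * \<gamma>) ^ length (filter (\<lambda>x. x = r) u) *
        (\<Sum>p\<in>words {..<r} (length (filter (\<lambda>x. x = r) u)). prod_list (map (\<lambda>x. b x r) p) *
           (let M = mset (filter (\<lambda>x. x \<noteq> r) u) + mset p in
               1 * (\<Prod>j<l. b (u ! j) (sorted_list_of_multiset M ! j))))))"
    unfolding sum_distrib_left
    by (intro arg_cong[where f = fps_total] ext sum.cong refl)
       (simp add: G_def words_def power_mult_distrib mult_ac)
  also have "\<dots> = \<gamma> * fps_total (\<lambda>l. \<Sum>w\<in>words {..<r} l.
      word_weight (\<lambda>i j. b i j + fps_X * \<gamma> * b r j * b i r) w)"
    unfolding fps_total_mult_left substitution_in_words[where g = "\<lambda>_. 1" and C = "\<lambda>M j. sorted_list_of_multiset M ! j"]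
    by (intro arg_cong[where f = "\<lambda>x. \<gamma> * x"] arg_cong[where f = fps_total] ext sum.cong refl)
       (simp add: word_weight_def prod_list_map2_nth words_def sorted_list_of_multiset_mset)
  finally show ?thesis by (simp add: word_series_def)
qed

section \<open>Words with threshold conditions\<close>

text \<open>
  The letters \<open>2 j\<close> and \<open>2 j + 1\<close> both carry the weight \<open>x j\<close>, and even letters carry an additional
  factor \<open>t\<close>. For \<open>a = 0\<close> an even letter may only stand where the sorted word has a letter at least as
  large, an odd letter only where it has a letter at most as large. The parameter \<open>a\<close> accounts for
  passages through larger letters already eliminated: they can lead from an even letter to
  anywhere, but never start at an odd letter.
\<close>

definition threshold_matrix :: "'a::field \<Rightarrow> (nat \<Rightarrow> 'a) \<Rightarrow> 'a fps \<Rightarrow> nat \<Rightarrow> nat \<Rightarrow> 'a fps" where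
  "threshold_matrix t x a i j =
     (if even i then fps_const (t * x (i div 2)) * (a + (if i \<le> j then 1 else 0))
      else fps_const (x (i div 2)) * (if j \<le> i then 1 else 0))"

lemma word_series_empty: "word_series {} b = 1"
proof -
  have "words {} (Suc n) = {}" for n
    by (auto simp: words_def)
  then show ?thesis
    unfolding word_series_def
    by (subst fps_total_Suc) (simp add: word_weight_def fps_total_def fps_zero_def[symmetric])
qed

text \<open>
  Eliminating the odd letter \<open>2 k + 1\<close> and then the even letter \<open>2 k\<close> only changes the parameter,
  from \<open>a\<close> to \<open>a'\<close> and then to \<open>a''\<close>. Both \<open>1 + a\<close> and \<open>1 + t a\<close> are thereby multiplied by products
  of linear factors and inverse pivots, so that the combination on the left reproduces itself.
\<close>

lemma word_series_threshold:
  fixes t :: "'a::field"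
  shows "word_series {..<2 * k} (threshold_matrix t x a) *
      ((1 + fps_const t * a) * (\<Prod>j<k. 1 - fps_const (x j) * fps_X) -
        fps_const t * (1 + a) * (\<Prod>j<k. 1 - fps_const (t * x j) * fps_X)) = fps_const (1 - t)"
proof (induction k arbitrary: a)
  case 0
  then show ?case
    by (simp add: word_series_empty ring_distribs flip: fps_const_sub)
next
  case (Suc k)
  define y where "y = fps_const (x k)"
  define T where "T = fps_const t"
  define P where "P = (\<Prod>j<k. 1 - fps_const (x j) * fps_X)"
  define Q where "Q = (\<Prod>j<k. 1 - fps_const (t * x j) * fps_X)"
  have ty: "fps_const (t * x k) = T * y"
    by (simp add: T_def y_def)
  define \<gamma> where "\<gamma> = inverse (1 - fps_X * y)"
  have \<gamma>: "\<gamma> * (1 - fps_X * y) = 1"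
    unfolding \<gamma>_def by (intro inverse_mult_eq_1) simp
  define a' where "a' = a + fps_X * \<gamma> * y * (1 + a)"
  define \<delta> where "\<delta> = inverse (1 - fps_X * (T * y * (1 + a')))"
  have \<delta>: "\<delta> * (1 - fps_X * (T * y * (1 + a'))) = 1"
    unfolding \<delta>_def by (intro inverse_mult_eq_1) simp
  define a'' where "a'' = a' + fps_X * \<delta> * (1 + a') * (T * y * a')"
  have odd_letter: "word_series {..2 * k + 1} (threshold_matrix t x a) =
      \<gamma> * word_series {..<2 * k + 1} (threshold_matrix t x a')"
  proof (subst word_series_eliminate[where \<gamma> = \<gamma>])
    show "\<gamma> * (1 - fps_X * threshold_matrix t x a (2 * k + 1) (2 * k + 1)) = 1"
      using \<gamma> by (simp add: threshold_matrix_def y_def)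
    show "\<gamma> * word_series {..<2 * k + 1} (\<lambda>i j. threshold_matrix t x a i j +
        fps_X * \<gamma> * threshold_matrix t x a (2 * k + 1) j * threshold_matrix t x a i (2 * k + 1)) =
        \<gamma> * word_series {..<2 * k + 1} (threshold_matrix t x a')"
      by (intro arg_cong[where f = "\<lambda>z. \<gamma> * z"] word_series_cong)
         (auto simp: threshold_matrix_def a'_def y_def[symmetric] algebra_simps)
  qed
  have even_letter: "word_series {..2 * k} (threshold_matrix t x a') =
      \<delta> * word_series {..<2 * k} (threshold_matrix t x a'')"
  proof (subst word_series_eliminate[where \<gamma> = \<delta>])
    show "\<delta> * (1 - fps_X * threshold_matrix t x a' (2 * k) (2 * k)) = 1"
      using \<delta> by (simp add: threshold_matrix_def ty add.commute)
    show "\<delta> * word_series {..<2 * k} (\<lambda>i j. threshold_matrix t x a' i j +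
        fps_X * \<delta> * threshold_matrix t x a' (2 * k) j * threshold_matrix t x a' i (2 * k)) =
        \<delta> * word_series {..<2 * k} (threshold_matrix t x a'')"
      by (intro arg_cong[where f = "\<lambda>z. \<delta> * z"] word_series_cong)
         (auto simp: threshold_matrix_def a''_def ty algebra_simps)
  qed
  have "{..<2 * Suc k} = {..2 * k + 1}" "{..<2 * k + 1} = {..2 * k}"
    by auto
  then have series: "word_series {..<2 * Suc k} (threshold_matrix t x a) =
      \<gamma> * \<delta> * word_series {..<2 * k} (threshold_matrix t x a'')"
    using odd_letter even_letter by (simp add: mult.assoc)
  have 1: "1 + a' = (1 + a) * \<gamma>"
  proof -
    have "1 + a' = (1 + a) * (1 + fps_X * \<gamma> * y)"
      by (simp add: a'_def algebra_simps)
    also have "1 + fps_X * \<gamma> * y = \<gamma>"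
      using \<gamma> by (simp add: algebra_simps)
    finally show ?thesis .
  qed
  have 2: "1 + a'' = (1 + a) * \<gamma> * (1 - T * y * fps_X) * \<delta>"
  proof -
    have "1 + a'' = (1 + a') * (1 + fps_X * \<delta> * (T * y * a'))"
      by (simp add: a''_def algebra_simps)
    also have "1 + fps_X * \<delta> * (T * y * a') = \<delta> * (1 - fps_X * (T * y * (1 + a'))) + fps_X * \<delta> * (T * y * a')"
      by (simp only: \<delta>)
    also have "\<dots> = (1 - T * y * fps_X) * \<delta>"
      by (simp add: algebra_simps)
    finally show ?thesis by (simp add: 1 mult.assoc)
  qed
  \<comment> \<open>Since \<open>1 + T a'' = (1 - T) + T (1 + a'')\<close>, inserting the pivot equations for 1 gives a common factor.\<close>
  have 3: "1 + T * a'' = \<gamma> * \<delta> * (1 + T * a) * (1 - y * fps_X)"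
  proof -
    have "1 + T * a'' = 1 - T + T * (1 + a'')"
      by (simp add: algebra_simps)
    also have "\<dots> = (1 - T) * (\<delta> * (1 - fps_X * (T * y * (1 + a')))) * (\<gamma> * (1 - fps_X * y)) +
        T * ((1 + a) * \<gamma> * (1 - T * y * fps_X) * \<delta>) * 1"
      by (simp only: 2 \<delta> \<gamma> mult_1_right)
    also have "\<dots> = \<gamma> * \<delta> * ((1 - T) * (1 - fps_X * y) - (1 - T) * T * fps_X * y * (1 + a) * (\<gamma> * (1 - fps_X * y)) +
        T * (1 + a) * (1 - T * y * fps_X))"
      by (simp only: 1) (simp add: algebra_simps)
    also have "\<dots> = \<gamma> * \<delta> * (1 + T * a) * (1 - y * fps_X)"
      by (simp only: \<gamma>) (simp add: algebra_simps)
    finally show ?thesis .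
  qed
  let ?Z = "(1 + T * a) * (P * (1 - y * fps_X)) - T * (1 + a) * (Q * (1 - T * y * fps_X))"
  let ?F = "word_series {..<2 * k} (threshold_matrix t x a'')"
  have "\<gamma> * \<delta> * ?F * ?Z = ?F * (\<gamma> * \<delta> * ?Z)"
    by (simp only: mult_ac)
  also have "\<gamma> * \<delta> * ?Z = (1 + T * a'') * P - T * (1 + a'') * Q"
    by (simp only: 2 3) (simp add: algebra_simps)
  also have "?F * \<dots> = fps_const (1 - t)"
    using Suc.IH[of a''] by (simp add: T_def P_def Q_def)
  finally show ?case
    unfolding series prod.lessThan_Suc ty T_def[symmetric] y_def[symmetric] P_def[symmetric] Q_def[symmetric] .
qed

section \<open>Words in which certain letters do not head their blocks\<close>

text \<open>
  In the sorted rearrangement of \<open>w\<close>, the block of the letter \<open>i\<close> begins at this index.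
\<close>

definition block_start :: "nat \<Rightarrow> nat list \<Rightarrow> nat" where
  "block_start i w = length (filter (\<lambda>x. x < i) w)"

text \<open>
  If the word has the letter \<open>i\<close> at the index \<open>block_start i w\<close>, then \<open>i\<close> occurs, so that its block is
  nonempty and the sorted word has the same letter there.
\<close>

definition heads_block :: "nat \<Rightarrow> nat list \<Rightarrow> bool" where
  "heads_block i w \<longleftrightarrow> block_start i w < length w \<and> w ! block_start i w = i"

definition insert_head :: "nat \<Rightarrow> nat list \<Rightarrow> nat list" where
  "insert_head i w = take (block_start i w) w @ i # drop (block_start i w) w"

definition delete_head :: "nat \<Rightarrow> nat list \<Rightarrow> nat list" where
  "delete_head i w = take (block_start i w) w @ drop (Suc (block_start i w)) w"

lemma block_start_le_length: "block_start i w \<le> length w"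
  by (simp add: block_start_def)

lemma block_start_append [simp]: "block_start i (u @ v) = block_start i u + block_start i v"
  by (simp add: block_start_def)

lemma block_start_Cons [simp]: "block_start i (x # v) = (if x < i then 1 else 0) + block_start i v"
  by (simp add: block_start_def)

lemma block_start_take_drop: "block_start i (take n w) + block_start i (drop n w) = block_start i w"
  by (metis append_take_drop_id block_start_append)

lemma block_start_insert_head:
  "block_start e (insert_head i w) = block_start e w + (if i < e then 1 else 0)"
  using block_start_take_drop[of e "block_start i w" w] by (simp add: insert_head_def)

lemma block_start_mono: "d \<le> e \<Longrightarrow> block_start d w \<le> block_start e w"
  by (induction w) (auto simp: block_start_def)

lemma block_start_less: "d < e \<Longrightarrow> d \<in> set w \<Longrightarrow> block_start d w < block_start e w"
proof (induction w)
  case (Cons x w)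
  then show ?case
    using block_start_mono[of d e w] by auto
qed simp

lemma delete_insert_head: "delete_head i (insert_head i w) = w"
proof -
  have "block_start i (insert_head i w) = block_start i w"
    by (simp add: block_start_insert_head)
  then show ?thesis
    using block_start_le_length[of i w] by (simp add: delete_head_def insert_head_def)
qed

lemma insert_delete_head:
  assumes "heads_block i w"
  shows "insert_head i (delete_head i w) = w"
proof -
  let ?l = "block_start i w"
  have l: "?l < length w" "w ! ?l = i"
    using assms by (auto simp: heads_block_def)
  have w: "w = take ?l w @ i # drop (Suc ?l) w"
    using l id_take_nth_drop by metis
  have "block_start i (delete_head i w) = ?l"
    using arg_cong[OF w, of "block_start i"] by (simp add: delete_head_def)
  then show ?thesis
    using l w by (simp add: insert_head_def delete_head_def min_def)
qed

lemma length_insert_head: "length (insert_head i w) = Suc (length w)"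
  using block_start_le_length[of i w] by (simp add: insert_head_def)

lemma nth_insert_head:
  "insert_head i w ! j = (if j < block_start i w then w ! j
     else if j = block_start i w then i else w ! (j - 1))"
  using block_start_le_length[of i w]
  by (auto simp: insert_head_def nth_append nth_Cons' min_def)

lemma heads_block_insert_head [simp]: "heads_block i (insert_head i w)"
  using block_start_le_length[of i w]
  by (simp add: heads_block_def block_start_insert_head nth_insert_head length_insert_head)

text \<open>
  Inserting \<open>i\<close> at the beginning of its block shifts later blocks by one place together with their
  contents, and it leaves earlier nonempty blocks alone. The start of an empty block of a letter
  \<open>e < i\<close> may coincide with the place of insertion, but then \<open>e\<close> does not occur at all.
\<close>

lemma heads_block_insert_head_other:
  assumes "e \<noteq> i"
  shows "heads_block e (insert_head i w) \<longleftrightarrow> heads_block e w"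
proof (cases "e < i")
  case True
  have "block_start e w \<le> block_start i w" "e \<in> set w \<Longrightarrow> block_start e w < block_start i w"
    using True by (auto intro: block_start_mono block_start_less)
  moreover have "heads_block e w \<Longrightarrow> e \<in> set w"
    by (metis heads_block_def nth_mem)
  ultimately show ?thesis
    using True block_start_le_length[of i w]
    by (cases "block_start e w = block_start i w")
       (auto simp: heads_block_def block_start_insert_head nth_insert_head length_insert_head)
next
  case False
  then have "block_start i w \<le> block_start e w"
    by (intro block_start_mono) simp
  then show ?thesis
    using False assms block_start_le_length[of i w]
    by (auto simp: heads_block_def block_start_insert_head nth_insert_head length_insert_head)
qed

lemma mset_insert_head: "mset (insert_head i w) = add_mset i (mset w)"
proof -
  have "mset (take n w) + mset (drop n w) = mset w" for n
    by (simp only: mset_append[symmetric] append_take_drop_id)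
  then show ?thesis by (simp add: insert_head_def)
qed

lemma sort_split_at: "sort w = sort (filter (\<lambda>x. x < i) w) @ sort (filter (\<lambda>x. \<not> x < i) w)"
  for w :: "nat list"
proof (rule properties_for_sort)
  show "mset (sort (filter (\<lambda>x. x < i) w) @ sort (filter (\<lambda>x. \<not> x < i) w)) = mset w"
    using multiset_partition[of "mset w" "\<lambda>x. x < i"] by simp
qed (auto simp: sorted_append)

lemma sort_insert_head:
  "sort (insert_head i w) = take (block_start i w) (sort w) @ i # drop (block_start i w) (sort w)"
proof -
  have "sort (insert_head i w) = sort (filter (\<lambda>x. x < i) w) @ i # sort (filter (\<lambda>x. \<not> x < i) w)"
  proof (rule properties_for_sort)
    show "mset (sort (filter (\<lambda>x. x < i) w) @ i # sort (filter (\<lambda>x. \<not> x < i) w)) = mset (insert_head i w)"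
      using multiset_partition[of "mset w" "\<lambda>x. x < i"] by (simp add: mset_insert_head)
  qed (auto simp: sorted_append)
  then show ?thesis
    by (simp add: sort_split_at[of w i] block_start_def)
qed

lemma word_weight_insert_head: "word_weight b (insert_head i w) = b i i * word_weight b w"
proof -
  let ?l = "block_start i w"
  have "word_weight b w = prod_list (map2 b (take ?l w @ drop ?l w) (take ?l (sort w) @ drop ?l (sort w)))"
    by (simp add: word_weight_def)
  also have "\<dots> = prod_list (map2 b (take ?l w) (take ?l (sort w))) * prod_list (map2 b (drop ?l w) (drop ?l (sort w)))"
    by (subst zip_append) auto
  finally show ?thesis
    unfolding word_weight_def[of b "insert_head i w"] sort_insert_head
    by (simp add: insert_head_def mult_ac)
qed

definition headless_words :: "nat set \<Rightarrow> nat set \<Rightarrow> nat \<Rightarrow> nat list set" where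
  "headless_words S A n = {w \<in> words A n. \<forall>e\<in>S. \<not> heads_block e w}"

text \<open>
  A word headed by \<open>i\<close> arises from a unique shorter word by inserting \<open>i\<close> at the beginning of its
  block, and the inserted letter contributes the factor \<open>b i i\<close> since it also appears at that place
  of the sorted word.
\<close>

lemma headless_words_insert:
  fixes b :: "nat \<Rightarrow> nat \<Rightarrow> 'a::comm_ring_1"
  assumes "finite A" "i \<in> A" "i \<notin> S"
  shows "(\<Sum>w\<in>headless_words (insert i S) A (Suc n). word_weight b w) =
     (\<Sum>w\<in>headless_words S A (Suc n). word_weight b w) - b i i * (\<Sum>w\<in>headless_words S A n. word_weight b w)"
proof -
  have set: "set (insert_head i w) = insert i (set w)" for w
    by (metis mset_insert_head set_mset_mset set_mset_add_mset_insert)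
  have "(\<Sum>w | w \<in> headless_words S A (Suc n) \<and> heads_block i w. word_weight b w) =
      (\<Sum>w\<in>headless_words S A n. b i i * word_weight b w)"
  proof (rule sum.reindex_bij_witness[of _ "insert_head i" "delete_head i"])
    fix w assume w: "w \<in> {w \<in> headless_words S A (Suc n). heads_block i w}"
    then show eq: "insert_head i (delete_head i w) = w"
      by (simp add: insert_delete_head)
    have "heads_block e (delete_head i w) \<longleftrightarrow> heads_block e w" if "e \<in> S" for e
      using that assms(3) heads_block_insert_head_other[of e i "delete_head i w"] eq by auto
    then show "delete_head i w \<in> headless_words S A n"
      using w length_insert_head[of i "delete_head i w"] set[of "delete_head i w"] unfolding eq
      by (auto simp: headless_words_def words_def)
    show "b i i * word_weight b (delete_head i w) = word_weight b w"
      by (metis eq word_weight_insert_head)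
  next
    fix w assume w: "w \<in> headless_words S A n"
    show "delete_head i (insert_head i w) = w"
      by (rule delete_insert_head)
    have "heads_block e (insert_head i w) \<longleftrightarrow> heads_block e w" if "e \<in> S" for e
      using that assms(3) by (intro heads_block_insert_head_other) auto
    then show "insert_head i w \<in> {w \<in> headless_words S A (Suc n). heads_block i w}"
      using w assms(2) set length_insert_head by (auto simp: headless_words_def words_def)
  qed
  moreover have "(\<Sum>w\<in>headless_words S A (Suc n). word_weight b w) =
      (\<Sum>w\<in>headless_words (insert i S) A (Suc n). word_weight b w) +
      (\<Sum>w | w \<in> headless_words S A (Suc n) \<and> heads_block i w. word_weight b w)"
    using finite_words[OF assms(1)] by (subst sum.union_disjoint[symmetric])
      (auto simp: headless_words_def intro!: sum.cong)
  ultimately show ?thesis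
    by (simp add: sum_distrib_left)
qed

lemma headless_words_series:
  fixes b :: "nat \<Rightarrow> nat \<Rightarrow> 'a::comm_ring_1"
  assumes "finite A" "S \<subseteq> A"
  shows "Abs_fps (\<lambda>n. \<Sum>w\<in>headless_words S A n. word_weight b w) =
     (\<Prod>i\<in>S. 1 - fps_const (b i i) * fps_X) * Abs_fps (\<lambda>n. \<Sum>w\<in>words A n. word_weight b w)"
proof -
  have "finite S" using assms finite_subset by blast
  then show ?thesis using assms(2)
  proof (induction S)
    case empty
    then show ?case by (simp add: headless_words_def)
  next
    case (insert i S)
    have "Abs_fps (\<lambda>n. \<Sum>w\<in>headless_words (insert i S) A n. word_weight b w) =
        (1 - fps_const (b i i) * fps_X) * Abs_fps (\<lambda>n. \<Sum>w\<in>headless_words S A n. word_weight b w)"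
      (is "_ = _ * ?F")
    proof (rule fps_ext)
      fix n
      have "headless_words T A 0 = {[]}" for T
        by (auto simp: headless_words_def heads_block_def)
      then show "Abs_fps (\<lambda>n. \<Sum>w\<in>headless_words (insert i S) A n. word_weight b w) $ n =
          ((1 - fps_const (b i i) * fps_X) * ?F) $ n"
        using insert.prems insert.hyps assms(1)
        by (cases n) (simp_all add: left_diff_distrib mult.assoc headless_words_insert)
    qed
    then show ?case
      using insert by (simp add: mult.assoc)
  qed
qed

section \<open>Words as pairs of a permutation and a sorted word\<close>

text \<open>
  The order in which stable sorting reads the places of \<open>w\<close>. Places are counted from 1, as in
  permutations of \<open>{1..n}\<close>, while list indices start at 0.
\<close>

definition reads_before :: "nat list \<Rightarrow> nat \<Rightarrow> nat \<Rightarrow> bool" where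
  "reads_before w k j \<longleftrightarrow> w ! (k - 1) < w ! (j - 1) \<or> (w ! (k - 1) = w ! (j - 1) \<and> k < j)"

definition rank :: "nat list \<Rightarrow> nat \<Rightarrow> nat" where
  "rank w j = (if j \<in> {1..length w} then Suc (card {k \<in> {1..length w}. reads_before w k j}) else j)"

text \<open>
  The pairs \<open>(c\<^sub>i, \<sigma>\<^sub>i)\<close> increase lexicographically; this characterises \<open>\<sigma>\<close> as the stable sorting of
  the word that has \<open>c\<^sub>i\<close> at the place \<open>\<sigma>\<^sub>i\<close>.
\<close>

definition compatible :: "nat \<Rightarrow> (nat \<Rightarrow> nat) \<Rightarrow> nat list \<Rightarrow> bool" where
  "compatible n \<sigma> c \<longleftrightarrow> (\<forall>i\<in>{1..n}. \<forall>j\<in>{1..n}. i < j \<longrightarrow>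
     c ! (i - 1) < c ! (j - 1) \<or> (c ! (i - 1) = c ! (j - 1) \<and> \<sigma> i < \<sigma> j))"

text \<open>
  The word with the letter \<open>c\<^sub>i\<close> at the place \<open>\<sigma>\<^sub>i\<close>.
\<close>

definition spread :: "nat \<Rightarrow> (nat \<Rightarrow> nat) \<Rightarrow> nat list \<Rightarrow> nat list" where
  "spread n \<sigma> c = map (\<lambda>j. c ! (inv \<sigma> j - 1)) [1..<Suc n]"

definition gather :: "nat \<Rightarrow> (nat \<Rightarrow> nat) \<Rightarrow> nat list \<Rightarrow> nat list" where
  "gather n \<sigma> w = map (\<lambda>i. w ! (\<sigma> i - 1)) [1..<Suc n]"

lemma length_spread [simp]: "length (spread n \<sigma> c) = n"
  and length_gather [simp]: "length (gather n \<sigma> c) = n"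
  by (simp_all add: spread_def gather_def)

lemma nth_spread: "j \<in> {1..n} \<Longrightarrow> spread n \<sigma> c ! (j - 1) = c ! (inv \<sigma> j - 1)"
  by (auto simp: spread_def simp del: upt_Suc)

lemma nth_gather: "j \<in> {1..n} \<Longrightarrow> gather n \<sigma> c ! (j - 1) = c ! (\<sigma> j - 1)"
  by (auto simp: gather_def simp del: upt_Suc)

lemma list_eq_from_1:
  assumes "length u = n" "length v = n" "\<And>j. j \<in> {1..n} \<Longrightarrow> u ! (j - 1) = v ! (j - 1)"
  shows "u = v"
proof (rule nth_equalityI)
  fix i assume "i < length u"
  then show "u ! i = v ! i" using assms(3)[of "Suc i"] assms(1) by simp
qed (use assms in simp)

lemma rank_less:
  assumes "k \<in> {1..length w}" "j \<in> {1..length w}" "reads_before w k j"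
  shows "rank w k < rank w j"
proof -
  have "{i \<in> {1..length w}. reads_before w i k} \<subset> {i \<in> {1..length w}. reads_before w i j}"
    using assms by (auto simp: reads_before_def)
  then have "card {i \<in> {1..length w}. reads_before w i k} < card {i \<in> {1..length w}. reads_before w i j}"
    by (intro psubset_card_mono) auto
  then show ?thesis using assms by (simp add: rank_def)
qed

lemma reads_before_total: "k \<noteq> j \<Longrightarrow> reads_before w k j \<or> reads_before w j k"
  by (auto simp: reads_before_def)

lemma rank_permutes: "rank w permutes {1..length w}"
proof (rule bij_imp_permutes)
  have inj: "inj_on (rank w) {1..length w}"
    by (rule inj_onI) (metis rank_less reads_before_total less_irrefl)
  have "rank w j \<in> {1..length w}" if "j \<in> {1..length w}" for j
  proof -
    have "{k \<in> {1..length w}. reads_before w k j} \<subseteq> {1..length w} - {j}"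
      by (auto simp: reads_before_def)
    then have "card {k \<in> {1..length w}. reads_before w k j} \<le> card ({1..length w} - {j})"
      by (intro card_mono) auto
    also have "\<dots> < length w" using that by (simp add: card_Diff_singleton) linarith
    finally show ?thesis using that by (simp add: rank_def)
  qed
  then have "rank w ` {1..length w} \<subseteq> {1..length w}" by auto
  then show "bij_betw (rank w) {1..length w} {1..length w}"
    using inj by (simp add: bij_betw_def endo_inj_surj)
qed (auto simp: rank_def)

lemma compatible_gather:
  "compatible (length w) (inv (rank w)) (gather (length w) (inv (rank w)) w)"
  unfolding compatible_def
proof (intro ballI impI)
  let ?\<sigma> = "inv (rank w)"
  fix i j assume ij: "i \<in> {1..length w}" "j \<in> {1..length w}" "i < j"
  have p: "?\<sigma> permutes {1..length w}" by (intro permutes_inv rank_permutes)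
  have r: "rank w (?\<sigma> i) = i" for i by (rule permutes_inverses[OF rank_permutes])
  have "?\<sigma> i \<in> {1..length w}" "?\<sigma> j \<in> {1..length w}"
    using ij permutes_in_image[OF p] by auto
  moreover have "?\<sigma> i \<noteq> ?\<sigma> j" using r ij by (metis less_irrefl)
  ultimately have "reads_before w (?\<sigma> i) (?\<sigma> j)"
    using reads_before_total rank_less r ij by (metis less_asym)
  then show "gather (length w) ?\<sigma> w ! (i - 1) < gather (length w) ?\<sigma> w ! (j - 1) \<or>
      gather (length w) ?\<sigma> w ! (i - 1) = gather (length w) ?\<sigma> w ! (j - 1) \<and> ?\<sigma> i < ?\<sigma> j"
    using ij by (simp only: nth_gather reads_before_def)
qed

lemma spread_gather:
  assumes "\<sigma> permutes {1..n}" "length w = n"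
  shows "spread n \<sigma> (gather n \<sigma> w) = w"
proof (rule list_eq_from_1)
  fix j assume j: "j \<in> {1..n}"
  then have "inv \<sigma> j \<in> {1..n}"
    using permutes_in_image[OF permutes_inv[OF assms(1)]] by blast
  then show "spread n \<sigma> (gather n \<sigma> w) ! (j - 1) = w ! (j - 1)"
    using j by (simp only: nth_spread nth_gather permutes_inverses[OF assms(1)])
qed (use assms in auto)

lemma gather_spread:
  assumes "\<sigma> permutes {1..n}" "length c = n"
  shows "gather n \<sigma> (spread n \<sigma> c) = c"
proof (rule list_eq_from_1)
  fix j assume j: "j \<in> {1..n}"
  then have "\<sigma> j \<in> {1..n}"
    using permutes_in_image[OF assms(1)] by blast
  then show "gather n \<sigma> (spread n \<sigma> c) ! (j - 1) = c ! (j - 1)"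
    using j by (simp only: nth_spread nth_gather permutes_inverses[OF assms(1)])
qed (use assms in auto)

text \<open>
  The places read before \<open>j\<close> in the word made from \<open>(\<sigma>, c)\<close> are the images of the numbers below
  \<open>inv \<sigma> j\<close>, because \<open>i \<mapsto> (c\<^sub>i, \<sigma>\<^sub>i)\<close> is strictly increasing.
\<close>

lemma rank_spread:
  assumes \<sigma>: "\<sigma> permutes {1..n}" and c: "compatible n \<sigma> c"
  shows "inv (rank (spread n \<sigma> c)) = \<sigma>"
proof -
  let ?w = "spread n \<sigma> c"
  have "rank ?w j = inv \<sigma> j" for j
  proof (cases "j \<in> {1..n}")
    case True
    have i: "inv \<sigma> k \<in> {1..n}" if "k \<in> {1..n}" for k
      using permutes_in_image[OF permutes_inv[OF \<sigma>]] that by blast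
    have "reads_before ?w k j \<longleftrightarrow> inv \<sigma> k < inv \<sigma> j" if k: "k \<in> {1..n}" for k
    proof -
      have s: "\<sigma> (inv \<sigma> k) = k" "\<sigma> (inv \<sigma> j) = j"
        using permutes_inverses[OF \<sigma>] by auto
      consider "inv \<sigma> k < inv \<sigma> j" | "k = j" | "inv \<sigma> j < inv \<sigma> k"
        using s by (metis linorder_neqE_nat)
      then show ?thesis
      proof cases
        case 1
        then show ?thesis
          using c i[OF k] i[OF True] s unfolding reads_before_def nth_spread[OF k] nth_spread[OF True] compatible_def by metis
      next
        case 2
        then show ?thesis by (simp add: reads_before_def)
      next
        case 3
        then have "reads_before ?w j k"
          using c i[OF k] i[OF True] s unfolding reads_before_def nth_spread[OF k] nth_spread[OF True] compatible_def by metis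
        with 3 show ?thesis by (auto simp: reads_before_def)
      qed
    qed
    then have "{k \<in> {1..n}. reads_before ?w k j} = {k \<in> {1..n}. inv \<sigma> k < inv \<sigma> j}"
      by blast
    also have "\<dots> = \<sigma> ` {1..<inv \<sigma> j}"
    proof (intro set_eqI iffI)
      fix k assume "k \<in> {k \<in> {1..n}. inv \<sigma> k < inv \<sigma> j}"
      then show "k \<in> \<sigma> ` {1..<inv \<sigma> j}"
        using i[of k] permutes_inverses(1)[OF \<sigma>, of k] by (intro image_eqI[of _ _ "inv \<sigma> k"]) auto
    next
      fix k assume "k \<in> \<sigma> ` {1..<inv \<sigma> j}"
      then obtain m where m: "k = \<sigma> m" "m \<in> {1..<inv \<sigma> j}" by blast
      then have "m \<in> {1..n}" using i[OF True] by auto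
      then have "\<sigma> m \<in> {1..n}" using permutes_in_image[OF \<sigma>] by blast
      with m show "k \<in> {k \<in> {1..n}. inv \<sigma> k < inv \<sigma> j}"
        using permutes_inverses(2)[OF \<sigma>] by auto
    qed
    also have "card \<dots> = inv \<sigma> j - 1"
      using permutes_inj[OF \<sigma>] by (subst card_image) (auto intro: inj_on_subset)
    finally show ?thesis
      using True i[OF True] by (simp add: rank_def)
  next
    case False
    then show ?thesis
      using permutes_not_in[OF permutes_inv[OF \<sigma>]] by (auto simp: rank_def)
  qed
  then have "rank ?w = inv \<sigma>" by blast
  then show ?thesis
    using inv_inv_eq[OF permutes_bij[OF \<sigma>]] by simp
qed

lemma mset_gather:
  assumes "\<sigma> permutes {1..n}" "length w = n"
  shows "mset (gather n \<sigma> w) = mset w"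
proof -
  have gen: "mset (map f [1..<Suc n]) = image_mset f (mset_set {1..n})" for f :: "nat \<Rightarrow> nat"
    by (simp only: mset_map mset_upt atLeastLessThanSuc_atLeastAtMost)
  have "gather n id w = w"
    using assms by (intro list_eq_from_1[of _ n]) (simp_all only: length_gather nth_gather id_apply)
  then have w: "mset w = image_mset (\<lambda>i. w ! (i - 1)) (mset_set {1..n})"
    using gen[of "\<lambda>i. w ! (id i - 1)"] unfolding gather_def by simp
  have "mset (gather n \<sigma> w) = image_mset (\<lambda>i. w ! (i - 1)) (image_mset \<sigma> (mset_set {1..n}))"
    unfolding gather_def gen by (simp add: image_mset.compositionality comp_def)
  then show ?thesis
    using permutes_image_mset[OF assms(1)] w by simp
qed

lemma mset_spread:
  assumes "\<sigma> permutes {1..n}" "length c = n"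
  shows "mset (spread n \<sigma> c) = mset c"
  using mset_gather[OF assms(1), of "spread n \<sigma> c"] gather_spread[OF assms] by simp

lemma sorted_compatible:
  assumes "compatible n \<sigma> c" "length c = n"
  shows "sorted c"
  unfolding sorted_iff_nth_mono_less
proof (intro allI impI)
  fix i j assume ij: "i < j" "j < length c"
  then have "Suc i \<in> {1..n}" "Suc j \<in> {1..n}" "Suc i < Suc j"
    using assms by auto
  then have "c ! (Suc i - 1) \<le> c ! (Suc j - 1)"
    using assms(1) unfolding compatible_def by (metis less_imp_le order_refl)
  then show "c ! i \<le> c ! j" by simp
qed

lemma sort_spread:
  assumes "\<sigma> permutes {1..n}" "compatible n \<sigma> c" "length c = n"
  shows "sort (spread n \<sigma> c) = c"
  using assms by (intro properties_for_sort) (simp_all add: mset_spread sorted_compatible)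

text \<open>
  Stable sorting and \<open>spread\<close> are inverse bijections, so a sum over words is a sum over
  compatible pairs.
\<close>

lemma sum_words_spread:
  "(\<Sum>w\<in>words A n. f w) =
     (\<Sum>(\<sigma>, c)\<in>(SIGMA \<sigma>:{\<sigma>. \<sigma> permutes {1..n}}. {c \<in> words A n. compatible n \<sigma> c}). f (spread n \<sigma> c))"
proof (rule sum.reindex_bij_witness[of _ "\<lambda>(\<sigma>, c). spread n \<sigma> c"
      "\<lambda>w. (inv (rank w), gather n (inv (rank w)) w)"])
  fix w assume "w \<in> words A n"
  then have n: "length w = n" and A: "set w \<subseteq> A" by (auto simp: words_def)
  have p: "inv (rank w) permutes {1..n}"
    using permutes_inv[OF rank_permutes] n by blast
  show "(case (inv (rank w), gather n (inv (rank w)) w) of (\<sigma>, c) \<Rightarrow> spread n \<sigma> c) = w"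
    using spread_gather[OF p n] by simp
  then show "(case (inv (rank w), gather n (inv (rank w)) w) of (\<sigma>, c) \<Rightarrow> f (spread n \<sigma> c)) = f w"
    by simp
  have "set (gather n (inv (rank w)) w) = set w"
    using mset_gather[OF p n] by (metis set_mset_mset)
  then show "(inv (rank w), gather n (inv (rank w)) w) \<in>
      (SIGMA \<sigma>:{\<sigma>. \<sigma> permutes {1..n}}. {c \<in> words A n. compatible n \<sigma> c})"
    using p A compatible_gather[of w] n by (simp add: words_def)
next
  fix x assume x: "x \<in> (SIGMA \<sigma>:{\<sigma>. \<sigma> permutes {1..n}}. {c \<in> words A n. compatible n \<sigma> c})"
  obtain \<sigma> c where sc: "x = (\<sigma>, c)" by (cases x)
  with x have p: "\<sigma> permutes {1..n}" "compatible n \<sigma> c" "length c = n" "set c \<subseteq> A"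
    by (auto simp: words_def)
  have "set (spread n \<sigma> c) = set c"
    using mset_spread[OF p(1,3)] by (metis set_mset_mset)
  then show "(case x of (\<sigma>, c) \<Rightarrow> spread n \<sigma> c) \<in> words A n"
    using p by (simp add: sc words_def)
  show "(inv (rank (case x of (\<sigma>, c) \<Rightarrow> spread n \<sigma> c)),
         gather n (inv (rank (case x of (\<sigma>, c) \<Rightarrow> spread n \<sigma> c))) (case x of (\<sigma>, c) \<Rightarrow> spread n \<sigma> c)) = x"
    using p by (simp add: sc rank_spread gather_spread)
qed

lemma sorted_nth_less_iff:
  assumes "sorted c" "k < length c"
  shows "c ! k < e \<longleftrightarrow> k < block_start e c"
proof -
  have c: "c = sort (filter (\<lambda>x. x < e) c) @ sort (filter (\<lambda>x. \<not> x < e) c)"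
    using sort_split_at[of c e] assms(1) by (simp add: sorted_sort_id)
  let ?u = "sort (filter (\<lambda>x. x < e) c)" and ?v = "sort (filter (\<lambda>x. \<not> x < e) c)"
  have l: "length ?u = block_start e c" by (simp add: block_start_def)
  show ?thesis
  proof (cases "k < block_start e c")
    case True
    then have "c ! k = ?u ! k" using l by (subst c) (simp add: nth_append)
    moreover have "?u ! k \<in> set ?u" using True l by (intro nth_mem) simp
    ultimately show ?thesis using True by simp
  next
    case False
    then have "c ! k = ?v ! (k - block_start e c)" using l by (subst c) (simp add: nth_append)
    moreover have "length ?u + length ?v = length c"
      by (subst (3) c) simp
    then have "?v ! (k - block_start e c) \<in> set ?v" using False l assms(2) by (intro nth_mem) simp
    ultimately show ?thesis using False by simp
  qed
qed

lemma sorted_nth_less_iff_position: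
  assumes "sorted c" "length c = n" "i \<in> {1..n}"
  shows "c ! (i - 1) < e \<longleftrightarrow> i \<le> block_start e c"
proof -
  have "i - 1 < length c" using assms by auto
  from sorted_nth_less_iff[OF assms(1) this, of e] show ?thesis
    using assms by auto
qed

definition within_threshold :: "nat \<Rightarrow> nat \<Rightarrow> bool" where
  "within_threshold i j \<longleftrightarrow> (if even i then i \<le> j else j \<le> i)"

text \<open>
  Consider the places \<open>l + 1, \<dots>, u\<close> where \<open>c\<close> has a given letter \<open>e\<close>; on them \<open>\<sigma>\<close> increases strictly.
  All of them satisfy \<open>\<sigma>\<^sub>i \<le> i\<close> if and only if their images are at most \<open>u\<close>, and all of them satisfy
  \<open>\<sigma>\<^sub>i > i\<close> if and only if their images exceed \<open>l + 1\<close>. In terms of \<open>w\<close>, whose places with letter \<open>e\<close>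
  are these images, the former is the threshold condition for odd letters, and the latter is the
  threshold condition for even letters together with \<open>e\<close> not being at the place \<open>l + 1\<close>.
\<close>

lemma excedance_parity_iff:
  assumes \<sigma>: "\<sigma> permutes {1..n}" and c: "compatible n \<sigma> c" and len: "length c = n"
  defines "w \<equiv> spread n \<sigma> c"
  shows "(\<forall>i\<in>{1..n}. even (c ! (i - 1)) \<longleftrightarrow> i < \<sigma> i) \<longleftrightarrow>
     (\<forall>j<n. within_threshold (w ! j) (c ! j)) \<and> (\<forall>e. even e \<longrightarrow> \<not> heads_block e w)"
    (is "?L \<longleftrightarrow> ?R")
proof -
  have in_range: "\<sigma> i \<in> {1..n}" "inv \<sigma> i \<in> {1..n}" if "i \<in> {1..n}" for i
    using that permutes_in_image[OF \<sigma>] permutes_in_image[OF permutes_inv[OF \<sigma>]] by auto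
  have wc: "w ! (\<sigma> i - 1) = c ! (i - 1)" if "i \<in> {1..n}" for i
    unfolding w_def nth_spread[OF in_range(1)[OF that]] permutes_inverses[OF \<sigma>] ..
  have sorted: "sorted c" using sorted_compatible[OF c len] .
  have le: "c ! (i - 1) \<le> c ! (j - 1)" if "i \<le> j" "i \<in> {1..n}" "j \<in> {1..n}" for i j
    using that sorted len by (intro sorted_nth_mono) auto
  have bs: "block_start e w = block_start e c" for e
    using mset_spread[OF \<sigma> len] unfolding w_def block_start_def
    by (metis mset_filter size_mset)
  note pos = sorted_nth_less_iff_position[OF sorted len]
  have lenw: "length w = n" by (simp add: w_def)
  show ?thesis
  proof
    assume L: ?L
    have "within_threshold (w ! j) (c ! j)" if "j < n" for j
    proof -
      define i where "i = inv \<sigma> (Suc j)"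
      have i: "i \<in> {1..n}" and si: "\<sigma> i = Suc j"
        using that in_range(2)[of "Suc j"] permutes_inverses[OF \<sigma>] by (auto simp: i_def)
      have "w ! j = c ! (i - 1)" using wc[OF i] si by simp
      moreover have "within_threshold (c ! (i - 1)) (c ! (\<sigma> i - 1))"
        using L i in_range(1)[OF i] le[of i "\<sigma> i"] le[of "\<sigma> i" i]
        unfolding within_threshold_def by (metis less_imp_le not_less)
      ultimately show ?thesis using si by simp
    qed
    moreover have "\<not> heads_block e w" if e: "even e" for e
    proof
      assume h: "heads_block e w"
      let ?l = "block_start e c"
      have l: "?l < n" "w ! ?l = e" using h lenw bs by (auto simp: heads_block_def)
      define i where "i = inv \<sigma> (Suc ?l)"
      have i: "i \<in> {1..n}" and si: "\<sigma> i = Suc ?l"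
        using l in_range(2)[of "Suc ?l"] permutes_inverses[OF \<sigma>] by (auto simp: i_def)
      have ce: "c ! (i - 1) = e" using wc[OF i] si l by simp
      then have "\<not> i \<le> ?l"
        using pos[OF i, of e] by simp
      with si i have "\<not> i < \<sigma> i" by auto
      with L i ce e show False by auto
    qed
    ultimately show ?R by blast
  next
    assume R: ?R
    have th: "within_threshold (c ! (i - 1)) (c ! (\<sigma> i - 1))" if "i \<in> {1..n}" for i
    proof -
      have "\<sigma> i - 1 < n" using in_range(1)[OF that] by auto
      then show ?thesis using R wc[OF that] by metis
    qed
    have incr: "\<sigma> k \<le> \<sigma> i" if "k \<le> i" "k \<in> {1..n}" "i \<in> {1..n}" "c ! (k - 1) = c ! (i - 1)" for k i
      using c that unfolding compatible_def by (metis le_eq_less_or_eq less_irrefl)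
    show ?L
    proof (intro ballI)
      fix i assume i: "i \<in> {1..n}"
      let ?e = "c ! (i - 1)"
      show "even ?e \<longleftrightarrow> i < \<sigma> i"
      proof (cases "even ?e")
        case True
        let ?l = "block_start ?e c"
        have l: "?l < i"
          using pos[OF i, of ?e] by auto
        \<comment> \<open>As \<open>\<sigma>\<close> increases on the block, its places up to \<open>i\<close> have \<open>i - l\<close> distinct images between \<open>l + 2\<close> and \<open>\<sigma> i\<close>.\<close>
        have "\<sigma> k \<in> {?l + 2..\<sigma> i}" if k: "k \<in> {?l + 1..i}" for k
        proof -
          have k1: "k \<in> {1..n}" using k i by auto
          have "\<not> c ! (k - 1) < ?e"
            using pos[OF k1, of ?e] k by auto
          moreover have "c ! (k - 1) \<le> ?e" using le k k1 i by auto
          ultimately have ck: "c ! (k - 1) = ?e" by simp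
          have "?e \<le> c ! (\<sigma> k - 1)" using th[OF k1] True ck by (simp add: within_threshold_def)
          then have "?l < \<sigma> k"
            using pos[OF in_range(1)[OF k1], of ?e] by auto
          moreover have "\<sigma> k - 1 \<noteq> ?l"
          proof
            assume eq: "\<sigma> k - 1 = ?l"
            have "w ! ?l = ?e" using wc[OF k1] ck eq by simp
            moreover have "?l < length w" using l i lenw by auto
            ultimately show False using R True bs by (auto simp: heads_block_def)
          qed
          ultimately show ?thesis
            using incr[OF _ k1 i ck] k in_range(1)[OF k1] by auto
        qed
        then have "\<sigma> ` {?l + 1..i} \<subseteq> {?l + 2..\<sigma> i}" by blast
        then have "card (\<sigma> ` {?l + 1..i}) \<le> card {?l + 2..\<sigma> i}"
          by (intro card_mono) auto
        also have "card (\<sigma> ` {?l + 1..i}) = card {?l + 1..i}"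
          by (intro card_image inj_on_subset[OF permutes_inj[OF \<sigma>]]) simp
        finally have "i < \<sigma> i" using l i by simp
        with True show ?thesis by simp
      next
        case False
        let ?u = "block_start (Suc ?e) c"
        have u: "i \<le> ?u" "?u \<le> n"
          using pos[OF i, of "Suc ?e"] len block_start_le_length[of "Suc ?e" c] by auto
        \<comment> \<open>Likewise the places of the block from \<open>i\<close> on have distinct images between \<open>\<sigma> i\<close> and \<open>u\<close>.\<close>
        have "\<sigma> k \<in> {\<sigma> i..?u}" if k: "k \<in> {i..?u}" for k
        proof -
          have k1: "k \<in> {1..n}" using k i u by auto
          have "c ! (k - 1) < Suc ?e"
            using pos[OF k1, of "Suc ?e"] k by auto
          moreover have "?e \<le> c ! (k - 1)" using le k k1 i by auto
          ultimately have ck: "c ! (i - 1) = c ! (k - 1)" by simp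
          have "c ! (\<sigma> k - 1) < Suc ?e" using th[OF k1] False ck by (simp add: within_threshold_def)
          then have "\<sigma> k \<le> ?u"
            using pos[OF in_range(1)[OF k1], of "Suc ?e"] by auto
          then show ?thesis
            using incr[OF _ i k1 ck] k in_range(1)[OF k1] by auto
        qed
        then have "\<sigma> ` {i..?u} \<subseteq> {\<sigma> i..?u}" by blast
        then have "card (\<sigma> ` {i..?u}) \<le> card {\<sigma> i..?u}"
          by (intro card_mono) auto
        also have "card (\<sigma> ` {i..?u}) = card {i..?u}"
          by (intro card_image inj_on_subset[OF permutes_inj[OF \<sigma>]]) simp
        finally have "\<not> i < \<sigma> i" using u i by auto
        with False show ?thesis by simp
      qed
    qed
  qed
qed

lemma headless_words_permutations:
  fixes wt :: "nat \<Rightarrow> 'a::comm_ring_1"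
  assumes "finite A"
  shows "(\<Sum>w\<in>headless_words {e\<in>A. even e} A n.
            word_weight (\<lambda>i j. if within_threshold i j then wt i else 0) w) =
     (\<Sum>\<sigma> | \<sigma> permutes {1..n}. \<Sum>c | c \<in> words A n \<and> compatible n \<sigma> c \<and>
        (\<forall>i\<in>{1..n}. even (c ! (i - 1)) \<longleftrightarrow> i < \<sigma> i). prod_list (map wt c))"
proof -
  define ok where "ok w \<longleftrightarrow> (\<forall>j<n. within_threshold (w ! j) (sort w ! j)) \<and> (\<forall>e. even e \<longrightarrow> \<not> heads_block e w)" for w
  have fin: "finite {\<sigma>. \<sigma> permutes {1..n}}" "finite (words A n)"
    using finite_permutations finite_words[OF assms] by auto
  have head_in: "heads_block e w \<Longrightarrow> e \<in> set w" for e w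
    by (metis heads_block_def nth_mem)
  have "(\<Sum>w\<in>headless_words {e\<in>A. even e} A n.
            word_weight (\<lambda>i j. if within_threshold i j then wt i else 0) w)
      = (\<Sum>w\<in>words A n. if ok w then prod_list (map wt w) else 0)"
  proof (rule sum.mono_neutral_cong_left[OF fin(2)])
    show "headless_words {e \<in> A. even e} A n \<subseteq> words A n"
      by (auto simp: headless_words_def)
    show "\<forall>w\<in>words A n - headless_words {e \<in> A. even e} A n. (if ok w then prod_list (map wt w) else 0) = 0"
      by (auto simp: headless_words_def ok_def)
    fix w assume w: "w \<in> headless_words {e \<in> A. even e} A n"
    then have len: "length w = n" and head: "\<And>e. even e \<Longrightarrow> \<not> heads_block e w"
      using head_in by (auto simp: headless_words_def words_def)
    have ww: "word_weight (\<lambda>i j. if within_threshold i j then wt i else 0) w =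
        (\<Prod>j<n. if within_threshold (w ! j) (sort w ! j) then wt (w ! j) else 0)"
      unfolding word_weight_def by (subst prod_list_map2_nth) (simp_all add: len)
    show "word_weight (\<lambda>i j. if within_threshold i j then wt i else 0) w =
        (if ok w then prod_list (map wt w) else 0)"
    proof (cases "ok w")
      case True
      have "prod_list (map wt w) = (\<Prod>j<n. wt (w ! j))"
        using len prod_list_map2_nth[of w w "\<lambda>i _. wt i"] by (simp add: map2_map_map[of _ id _ id, simplified] zip_same_conv_map o_def)
      then show ?thesis using True unfolding ww by (auto simp: ok_def intro!: prod.cong)
    next
      case False
      then obtain j where "j < n" "\<not> within_threshold (w ! j) (sort w ! j)"
        using head by (auto simp: ok_def)
      then show ?thesis using False unfolding ww by (auto intro!: prod_zero)
    qed
  qed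
  also have "\<dots> = (\<Sum>(\<sigma>, c)\<in>(SIGMA \<sigma>:{\<sigma>. \<sigma> permutes {1..n}}. {c \<in> words A n. compatible n \<sigma> c}).
      if ok (spread n \<sigma> c) then prod_list (map wt (spread n \<sigma> c)) else 0)"
    by (rule sum_words_spread)
  also have "\<dots> = (\<Sum>(\<sigma>, c)\<in>(SIGMA \<sigma>:{\<sigma>. \<sigma> permutes {1..n}}. {c \<in> words A n. compatible n \<sigma> c}).
      if \<forall>i\<in>{1..n}. even (c ! (i - 1)) \<longleftrightarrow> i < \<sigma> i then prod_list (map wt c) else 0)"
  proof (rule sum.cong[OF refl], clarify)
    fix \<sigma> c assume p: "\<sigma> permutes {1..n}" "compatible n \<sigma> c" "c \<in> words A n"
    then have len: "length c = n" by (simp add: words_def)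
    have "prod_list (map wt (spread n \<sigma> c)) = prod_list (map wt c)"
      using mset_spread[OF p(1) len] by (metis mset_map prod_mset_prod_list)
    moreover have "ok (spread n \<sigma> c) \<longleftrightarrow> (\<forall>i\<in>{1..n}. even (c ! (i - 1)) \<longleftrightarrow> i < \<sigma> i)"
      unfolding excedance_parity_iff[OF p(1,2) len] ok_def sort_spread[OF p(1,2) len] ..
    ultimately show "(if ok (spread n \<sigma> c) then prod_list (map wt (spread n \<sigma> c)) else 0) =
        (if \<forall>i\<in>{1..n}. even (c ! (i - 1)) \<longleftrightarrow> i < \<sigma> i then prod_list (map wt c) else 0)"
      by simp
  qed
  also have "\<dots> = (\<Sum>\<sigma> | \<sigma> permutes {1..n}. \<Sum>c | c \<in> words A n \<and> compatible n \<sigma> c.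
      if \<forall>i\<in>{1..n}. even (c ! (i - 1)) \<longleftrightarrow> i < \<sigma> i then prod_list (map wt c) else 0)"
    using fin by (subst sum.Sigma) auto
  also have "\<dots> = (\<Sum>\<sigma> | \<sigma> permutes {1..n}. \<Sum>c | c \<in> words A n \<and> compatible n \<sigma> c \<and>
        (\<forall>i\<in>{1..n}. even (c ! (i - 1)) \<longleftrightarrow> i < \<sigma> i). prod_list (map wt c))"
    using fin by (intro sum.cong[OF refl]) (simp add: sum.inter_filter[symmetric] conj_assoc)
  finally show ?thesis .
qed

section \<open>Descents after lowering the excedance letters\<close>

text \<open>
  The descents of \<open>\<sigma>\<close> with respect to the order in which every excedance letter is smaller than
  every other letter.
\<close>

definition excedance_descents :: "nat \<Rightarrow> (nat \<Rightarrow> nat) \<Rightarrow> nat set" where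
  "excedance_descents n \<sigma> = {i \<in> {1..<n}. (\<not> i < \<sigma> i \<and> Suc i < \<sigma> (Suc i)) \<or>
     ((i < \<sigma> i \<longleftrightarrow> Suc i < \<sigma> (Suc i)) \<and> \<sigma> i > \<sigma> (Suc i))}"

lemma sum_by_parts:
  fixes e :: "nat \<Rightarrow> int"
  assumes "e n = 0"
  shows "(\<Sum>i\<in>{1..<n}. int i * (e (Suc i) - e i)) = - (\<Sum>i\<in>{1..<n}. e i)"
proof -
  have "(\<Sum>i\<in>{1..<Suc m}. int i * (e (Suc i) - e i)) = int m * e (Suc m) - (\<Sum>i\<in>{1..<Suc m}. e i)" for m
    by (induction m) (simp_all add: algebra_simps)
  from this[of "n - 1"] show ?thesis
    using assms by (cases n) auto
qed

text \<open>
  Lowering the excedance letters destroys the descent at \<open>i\<close> if only \<open>i\<close> is an excedance, since then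
  \<open>\<sigma>\<^sub>i \<ge> i + 1 \<ge> \<sigma>\<^sub>i\<^sub>+\<^sub>1\<close>, and creates one if only \<open>i + 1\<close> is. With \<open>e\<close> the indicator function of
  excedances, the change at \<open>i\<close> is thus \<open>e (i + 1) - e i\<close>, and summation by parts applies.
\<close>

lemma sum_excedance_descents:
  assumes "\<sigma> permutes {1..n}"
  shows "\<Sum>(excedance_descents n \<sigma>) + exc n \<sigma> = maj n \<sigma>"
proof -
  define e :: "nat \<Rightarrow> int" where "e i = (if i < \<sigma> i then 1 else 0)" for i
  have diff: "(if i \<in> excedance_descents n \<sigma> then 1 else 0) - (if i \<in> DES n \<sigma> then 1 else 0) = e (Suc i) - e i"
    if "i \<in> {1..<n}" for i
  proof -
    have "\<sigma> i \<noteq> \<sigma> (Suc i)"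
      using permutes_inj[OF assms] by (metis injD n_not_Suc_n)
    then show ?thesis
      using that by (auto simp: e_def excedance_descents_def DES_def)
  qed
  have indicator_sum: "int (\<Sum>X) = (\<Sum>i\<in>{1..<n}. int i * (if i \<in> X then 1 else 0))"
    if "X \<subseteq> {1..<n}" for X
  proof -
    have "int (\<Sum>X) = (\<Sum>i\<in>{1..<n}. if i \<in> X then int i else 0)"
      using that by (simp add: sum.inter_restrict[symmetric] Int_absorb1)
    also have "\<dots> = (\<Sum>i\<in>{1..<n}. int i * (if i \<in> X then 1 else 0))"
      by (intro sum.cong) auto
    finally show ?thesis .
  qed
  have "e n = 0"
  proof (cases "n = 0")
    case True
    then show ?thesis using assms by (simp add: e_def)
  next
    case False
    then have "\<sigma> n \<in> {1..n}" using permutes_in_image[OF assms] by simp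
    then show ?thesis by (simp add: e_def)
  qed
  have "int (\<Sum>(excedance_descents n \<sigma>)) - int (maj n \<sigma>) =
      (\<Sum>i\<in>{1..<n}. int i * ((if i \<in> excedance_descents n \<sigma> then 1 else 0) - (if i \<in> DES n \<sigma> then 1 else 0)))"
    unfolding maj_def by (subst (1 2) indicator_sum)
      (auto simp: excedance_descents_def DES_def sum_subtractf right_diff_distrib)
  also have "\<dots> = (\<Sum>i\<in>{1..<n}. int i * (e (Suc i) - e i))"
    by (intro sum.cong refl) (simp only: diff)
  also have "\<dots> = - (\<Sum>i\<in>{1..<n}. e i)"
    by (rule sum_by_parts[where e = e and n = n, OF \<open>e n = 0\<close>])
  also have "(\<Sum>i\<in>{1..<n}. e i) = int (exc n \<sigma>)"
    by (simp add: e_def exc_def sum.If_cases Int_def)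
  finally show ?thesis by linarith
qed

section \<open>Weakly decreasing sequences of bounded size\<close>

text \<open>
  The Gaussian binomial coefficient of \<open>N + n - 1\<close> over \<open>n\<close>, which is the complete homogeneous
  symmetric polynomial of degree \<open>n\<close> in \<open>1, q, \<dots>, q\<^bsup>N - 1\<^esup>\<close>. It is given in product form because
  this exhibits it as a polynomial in \<open>q\<^sup>N\<close>.
\<close>

definition complete_geometric :: "'a::field \<Rightarrow> nat \<Rightarrow> nat \<Rightarrow> 'a" where
  "complete_geometric q n N = (\<Prod>i<n. (1 - q ^ (N + i)) / (1 - q ^ Suc i))"

lemma complete_geometric_0 [simp]: "complete_geometric q 0 N = 1"
  by (simp add: complete_geometric_def)

lemma complete_geometric_Suc_0 [simp]: "complete_geometric q (Suc n) 0 = 0"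
  unfolding complete_geometric_def by (rule prod_zero) (auto intro!: bexI[of _ 0])

lemma complete_geometric_Suc_Suc:
  fixes q :: "'a::field"
  assumes "\<And>i. q ^ Suc i \<noteq> 1"
  shows "complete_geometric q (Suc n) (Suc N) =
     complete_geometric q (Suc n) N + q ^ N * complete_geometric q n (Suc N)"
proof -
  have nz: "1 - q ^ Suc n \<noteq> 0" using assms[of n] by simp
  have 1: "complete_geometric q (Suc n) (Suc N) =
      complete_geometric q n (Suc N) * ((1 - q ^ (Suc N + n)) / (1 - q ^ Suc n))"
    by (simp add: complete_geometric_def)
  have "(\<Prod>i<Suc n. 1 - q ^ (N + i)) = (1 - q ^ N) * (\<Prod>i<n. 1 - q ^ (Suc N + i))"
    by (subst prod.lessThan_Suc_shift) simp
  then have 2: "complete_geometric q (Suc n) N =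
      complete_geometric q n (Suc N) * ((1 - q ^ N) / (1 - q ^ Suc n))"
    unfolding complete_geometric_def prod_dividef by simp
  have "(1 - q ^ (Suc N + n)) / (1 - q ^ Suc n) = (1 - q ^ N) / (1 - q ^ Suc n) + q ^ N"
    using nz by (simp add: field_simps power_add)
  then show ?thesis unfolding 1 2 by (simp add: ring_distribs)
qed

text \<open>
  Truncated subtraction is harmless: the terms with \<open>x < d\<close> vanish if \<open>n > 0\<close>.
\<close>

lemma sum_complete_geometric:
  fixes q :: "'a::field"
  assumes "\<And>i. q ^ Suc i \<noteq> 1" and "0 < n \<or> d = 0"
  shows "(\<Sum>x<N. q ^ x * complete_geometric q n (Suc x - d)) = q ^ d * complete_geometric q (Suc n) (N - d)"
proof (induction N)
  case (Suc N)
  show ?case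
  proof (cases "d \<le> N")
    case True
    then have "q ^ d * complete_geometric q (Suc n) (Suc (N - d)) =
        q ^ d * complete_geometric q (Suc n) (N - d) + q ^ N * complete_geometric q n (Suc (N - d))"
      by (subst complete_geometric_Suc_Suc[OF assms(1)]) (simp_all add: ring_distribs flip: power_add mult.assoc)
    then show ?thesis using Suc True by (simp add: Suc_diff_le)
  next
    case False
    moreover obtain m where "n = Suc m" using assms(2) False by (cases n) auto
    ultimately show ?thesis using Suc by simp
  qed
qed simp

text \<open>
  The set \<open>S\<close> of strict descents counts places from 1: the number \<open>i + 1\<close> refers to the step from
  index \<open>i\<close> to index \<open>i + 1\<close> of the list.
\<close>

definition descending :: "nat set \<Rightarrow> nat list \<Rightarrow> bool" where
  "descending S s \<longleftrightarrow> (\<forall>i. Suc i < length s \<longrightarrow> s ! Suc i \<le> s ! i \<and> (Suc i \<in> S \<longrightarrow> s ! Suc i < s ! i))"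

lemma descending_Cons:
  "descending S (x # y # s) \<longleftrightarrow> y < (if 1 \<in> S then x else Suc x) \<and> descending {i. Suc i \<in> S} (y # s)"
proof -
  have "(\<forall>i. P i) \<longleftrightarrow> P 0 \<and> (\<forall>i. P (Suc i))" for P :: "nat \<Rightarrow> bool"
    by (metis not0_implies_Suc)
  note split = this[of "\<lambda>i. Suc i < length (x # y # s) \<longrightarrow> (x # y # s) ! Suc i \<le> (x # y # s) ! i \<and>
    (Suc i \<in> S \<longrightarrow> (x # y # s) ! Suc i < (x # y # s) ! i)"]
  show ?thesis
    unfolding descending_def[of S] split by (auto simp: descending_def)
qed

lemma descending_le_head: "descending S (y # s) \<Longrightarrow> x \<in> set (y # s) \<Longrightarrow> x \<le> y"
proof (induction s arbitrary: S y)
  case (Cons z s)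
  then show ?case
    by (auto simp: descending_Cons split: if_splits dest!: Cons.IH intro: order_trans less_imp_le)
qed simp

text \<open>
  Lowering every entry of the sequence by the number of strict descents after it gives an arbitrary
  weakly decreasing sequence with a smaller bound, and lowers the total by the sum of the strict
  descents. The induction instead fixes the first entry \<open>x\<close>, which bounds the remaining ones.
\<close>

lemma sum_descending:
  fixes q :: "'a::field"
  assumes "\<And>i. q ^ Suc i \<noteq> 1"
  shows "(\<Sum>s | s \<in> words {..<N} n \<and> descending S s. prod_list (map (\<lambda>x. q ^ x) s)) =
     q ^ (\<Sum>(S \<inter> {1..<n})) * complete_geometric q n (N - card (S \<inter> {1..<n}))"
proof (induction n arbitrary: S N)
  case 0
  have "{s \<in> words {..<N} 0. descending S s} = {[]}" by (auto simp: descending_def)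
  then show ?case by simp
next
  case (Suc n)
  \<comment> \<open>The strict descents of the list without its first entry.\<close>
  define S' where "S' = {i. Suc i \<in> S}"
  define d where "d = card (S \<inter> {1..<Suc n})"
  let ?f = "\<lambda>s. prod_list (map (\<lambda>x. q ^ x) s)"
  have fin: "finite (words {..<N} m)" for N m by (simp add: finite_words)
  have shift: "S \<inter> {1..<Suc n} = Suc ` (S' \<inter> {0..<n})"
  proof (rule set_eqI)
    fix i show "i \<in> S \<inter> {1..<Suc n} \<longleftrightarrow> i \<in> Suc ` (S' \<inter> {0..<n})"
      by (cases i) (auto simp: S'_def)
  qed
  have d: "d = card (S' \<inter> {0..<n})"
    unfolding d_def shift by (simp add: card_image)
  have inner: "(\<Sum>s | s \<in> words {..<N} n \<and> descending S (x # s). ?f s) =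
      q ^ (\<Sum>(S' \<inter> {1..<n})) * complete_geometric q n (Suc x - d)" if "x < N" for x
  proof (cases n)
    case 0
    have "{s \<in> words {..<N} 0. descending S (x # s)} = {[]}" by (auto simp: descending_def)
    then show ?thesis using 0 by simp
  next
    case (Suc m)
    let ?N = "if 1 \<in> S then x else Suc x"
    have "{s \<in> words {..<N} n. descending S (x # s)} = {s \<in> words {..<?N} n. descending S' s}"
    proof (intro set_eqI iffI)
      fix s assume s: "s \<in> {s \<in> words {..<N} n. descending S (x # s)}"
      then obtain y s' where ys: "s = y # s'" using Suc by (cases s) (auto simp: words_def)
      then have "y < ?N" "descending S' (y # s')"
        using s by (auto simp: descending_Cons S'_def)
      moreover have "z < ?N" if "z \<in> set s" for z
        using descending_le_head[of S' y s' z] that ys calculation by (meson le_less_trans)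
      ultimately show "s \<in> {s \<in> words {..<?N} n. descending S' s}"
        using s ys by (simp add: words_def subset_iff)
    next
      fix s assume s: "s \<in> {s \<in> words {..<?N} n. descending S' s}"
      then obtain y s' where ys: "s = y # s'" using Suc by (cases s) (auto simp: words_def)
      have "?N \<le> N" using that by simp
      then have "set s \<subseteq> {..<N}" using s by (auto simp: words_def)
      then show "s \<in> {s \<in> words {..<N} n. descending S (x # s)}"
        using s ys by (auto simp: words_def descending_Cons S'_def)
    qed
    then have "(\<Sum>s | s \<in> words {..<N} n \<and> descending S (x # s). ?f s) =
        q ^ (\<Sum>(S' \<inter> {1..<n})) * complete_geometric q n (?N - card (S' \<inter> {1..<n}))"
      using Suc.IH[of ?N S'] by simp
    moreover have "d = card (S' \<inter> {1..<n}) + (if 1 \<in> S then 1 else 0)"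
    proof -
      have "S' \<inter> {0..<n} = (if 1 \<in> S then insert 0 (S' \<inter> {1..<n}) else S' \<inter> {1..<n})"
        using Suc by (auto simp: S'_def) (metis One_nat_def Suc_leI not_gr0)
      then show ?thesis
        unfolding d by simp
    qed
    ultimately show ?thesis by simp
  qed
  have d0: "n = 0 \<Longrightarrow> d = 0" by (auto simp: d_def)
  have exponent: "\<Sum>(S \<inter> {1..<Suc n}) = \<Sum>(S' \<inter> {1..<n}) + d"
  proof -
    have "\<Sum>(S \<inter> {1..<Suc n}) = (\<Sum>i\<in>S' \<inter> {0..<n}. i + 1)"
      unfolding shift by (subst sum.reindex) auto
    also have "\<dots> = \<Sum>(S' \<inter> {0..<n}) + d"
      unfolding sum.distrib d by simp
    also have "\<Sum>(S' \<inter> {0..<n}) = \<Sum>(S' \<inter> {1..<n})"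
      by (rule sum.mono_neutral_right) auto
    finally show ?thesis .
  qed
  have "(\<Sum>s | s \<in> words {..<N} (Suc n) \<and> descending S s. ?f s) =
      (\<Sum>s\<in>words {..<N} (Suc n). if descending S s then ?f s else 0)"
    using fin by (simp add: sum.inter_filter)
  also have "\<dots> = (\<Sum>x<N. \<Sum>s\<in>words {..<N} n. if descending S (x # s) then q ^ x * ?f s else 0)"
    by (simp add: sum_words_Suc cong: if_cong)
  also have "\<dots> = (\<Sum>x<N. q ^ x * (\<Sum>s | s \<in> words {..<N} n \<and> descending S (x # s). ?f s))"
    using fin by (intro sum.cong refl) (simp add: sum.inter_filter sum_distrib_left if_distrib cong: if_cong)
  also have "\<dots> = (\<Sum>x<N. q ^ (\<Sum>(S' \<inter> {1..<n})) * (q ^ x * complete_geometric q n (Suc x - d)))"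
    by (intro sum.cong refl) (simp add: inner)
  also have "\<dots> = q ^ (\<Sum>(S' \<inter> {1..<n})) * (q ^ d * complete_geometric q (Suc n) (N - d))"
    unfolding sum_distrib_left[symmetric]
    using d0 by (subst sum_complete_geometric[OF assms]) auto
  also have "\<dots> = q ^ (\<Sum>(S \<inter> {1..<Suc n})) * complete_geometric q (Suc n) (N - d)"
    unfolding exponent by (simp add: power_add)
  finally show ?case by (simp add: d_def)
qed

lemma complete_geometric_series:
  fixes q :: "'a::field"
  assumes "\<And>i. q ^ Suc i \<noteq> 1"
  shows "Abs_fps (\<lambda>n. c ^ n * complete_geometric q n N) * (\<Prod>s<N. 1 - fps_const (c * q ^ s) * fps_X) = 1"
proof (induction N)
  case 0
  have "Abs_fps (\<lambda>n. c ^ n * complete_geometric q n 0) = 1"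
  proof (rule fps_ext)
    fix n show "Abs_fps (\<lambda>n. c ^ n * complete_geometric q n 0) $ n = 1 $ n"
      by (cases n) simp_all
  qed
  then show ?case by simp
next
  case (Suc N)
  have "Abs_fps (\<lambda>n. c ^ n * complete_geometric q n (Suc N)) * (1 - fps_const (c * q ^ N) * fps_X) =
      Abs_fps (\<lambda>n. c ^ n * complete_geometric q n N)"
  proof (rule fps_ext)
    fix n show "(Abs_fps (\<lambda>n. c ^ n * complete_geometric q n (Suc N)) * (1 - fps_const (c * q ^ N) * fps_X)) $ n =
        Abs_fps (\<lambda>n. c ^ n * complete_geometric q n N) $ n"
      by (cases n) (simp_all add: right_diff_distrib mult.assoc[symmetric] complete_geometric_Suc_Suc[OF assms],
        simp add: algebra_simps)
  qed
  moreover have "A * (P * B) = (A * B) * P" for A B P :: "'a fps"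
    by (simp only: mult_ac)
  ultimately show ?case using Suc by (simp only: prod.lessThan_Suc)
qed

section \<open>An algebraic limit\<close>

text \<open>
  A substitute for the limit \<open>N \<rightarrow> \<infinity>\<close> in a field without topology: as \<open>q\<^sup>N\<close> would tend to 0, a
  polynomial in \<open>q\<^sup>N\<close> has its constant term as limit.
\<close>

definition power_limit :: "'a::field \<Rightarrow> (nat \<Rightarrow> 'a) \<Rightarrow> 'a \<Rightarrow> bool" where
  "power_limit q f L \<longleftrightarrow> (\<exists>p. poly p 0 = L \<and> (\<forall>\<^sub>F N in sequentially. f N = poly p (q ^ N)))"

lemma power_limit_const: "power_limit q (\<lambda>_. c) c"
  unfolding power_limit_def by (rule exI[of _ "[:c:]"]) simp

lemma power_limit_add:
  assumes "power_limit q f L" "power_limit q g K"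
  shows "power_limit q (\<lambda>N. f N + g N) (L + K)"
proof -
  from assms obtain p r where "poly p 0 = L" "\<forall>\<^sub>F N in sequentially. f N = poly p (q ^ N)"
    "poly r 0 = K" "\<forall>\<^sub>F N in sequentially. g N = poly r (q ^ N)"
    by (auto simp: power_limit_def)
  then show ?thesis
    unfolding power_limit_def by (intro exI[of _ "p + r"]) (auto elim: eventually_elim2)
qed

lemma power_limit_mult:
  assumes "power_limit q f L" "power_limit q g K"
  shows "power_limit q (\<lambda>N. f N * g N) (L * K)"
proof -
  from assms obtain p r where "poly p 0 = L" "\<forall>\<^sub>F N in sequentially. f N = poly p (q ^ N)"
    "poly r 0 = K" "\<forall>\<^sub>F N in sequentially. g N = poly r (q ^ N)"
    by (auto simp: power_limit_def)
  then show ?thesis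
    unfolding power_limit_def by (intro exI[of _ "p * r"]) (auto elim: eventually_elim2)
qed

lemma power_limit_sum:
  assumes "\<And>x. x \<in> A \<Longrightarrow> power_limit q (f x) (L x)"
  shows "power_limit q (\<lambda>N. \<Sum>x\<in>A. f x N) (\<Sum>x\<in>A. L x)"
  using assms
proof (induction A rule: infinite_finite_induct)
  case (insert x A)
  then show ?case by (simp add: power_limit_add)
qed (simp_all add: power_limit_const)

text \<open>
  The difference of two polynomials describing \<open>f\<close> vanishes at \<open>q\<^sup>N\<close> for all large \<open>N\<close>, hence at
  infinitely many points.
\<close>

lemma power_limit_unique:
  assumes inj: "inj (\<lambda>N. q ^ N)" and "power_limit q f L" "power_limit q f K"
  shows "L = K"
proof -
  from assms obtain p r where p: "poly p 0 = L" "\<forall>\<^sub>F N in sequentially. f N = poly p (q ^ N)"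
    and r: "poly r 0 = K" "\<forall>\<^sub>F N in sequentially. f N = poly r (q ^ N)"
    by (auto simp: power_limit_def)
  have "\<forall>\<^sub>F N in sequentially. poly (p - r) (q ^ N) = 0"
    using p(2) r(2) by eventually_elim simp
  then obtain M where M: "\<And>N. N \<ge> M \<Longrightarrow> poly (p - r) (q ^ N) = 0"
    by (auto simp: eventually_sequentially)
  have "infinite ((\<lambda>N. q ^ N) ` {M..})"
    using inj by (metis finite_imageD infinite_Ici inj_on_subset subset_UNIV)
  moreover have "(\<lambda>N. q ^ N) ` {M..} \<subseteq> {x. poly (p - r) x = 0}"
    using M by auto
  ultimately have "p - r = 0"
    using poly_roots_finite finite_subset by blast
  then show ?thesis using p r by simp
qed

lemma power_limit_complete_geometric:
  fixes q :: "'a::field"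
  assumes "q \<noteq> 0"
  shows "power_limit q (\<lambda>N. complete_geometric q n (N - d)) (1 / (\<Prod>i<n. 1 - q ^ Suc i))"
  unfolding power_limit_def
proof (intro exI conjI)
  let ?p = "smult (1 / (\<Prod>i<n. 1 - q ^ Suc i)) (\<Prod>i<n. [:1, - (q ^ i / q ^ d):])"
  show "poly ?p 0 = 1 / (\<Prod>i<n. 1 - q ^ Suc i)"
    by (simp add: poly_prod)
  show "\<forall>\<^sub>F N in sequentially. complete_geometric q n (N - d) = poly ?p (q ^ N)"
    using eventually_ge_at_top[of d]
  proof eventually_elim
    case (elim N)
    have "q ^ (N - d + i) = q ^ N * (q ^ i / q ^ d)" for i
      using elim assms by (simp add: power_add power_diff)
    then show ?case
      by (simp add: complete_geometric_def prod_dividef poly_prod)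
  qed
qed

section \<open>The identity for bounded sequences\<close>

lemma prod_list_map_positions:
  "length c = n \<Longrightarrow> prod_list (map f c) = (\<Prod>i\<in>{1..n}. f (c ! (i - 1)) :: 'a::comm_monoid_mult)"
proof -
  assume len: "length c = n"
  have "prod_list (map f c) = (\<Prod>k<length c. f (c ! k))"
    by (induction c) (simp_all add: prod.lessThan_Suc_shift del: prod.lessThan_Suc)
  then show ?thesis
    using len by (simp add: prod.atLeast1_atMost_eq)
qed

lemma compatible_iff_adjacent:
  "compatible n \<sigma> c \<longleftrightarrow> (\<forall>i\<in>{1..<n}. c ! (i - 1) < c ! i \<or> (c ! (i - 1) = c ! i \<and> \<sigma> i < \<sigma> (Suc i)))"
proof
  assume "compatible n \<sigma> c"
  then show "\<forall>i\<in>{1..<n}. c ! (i - 1) < c ! i \<or> (c ! (i - 1) = c ! i \<and> \<sigma> i < \<sigma> (Suc i))"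
    unfolding compatible_def by force
next
  assume adj: "\<forall>i\<in>{1..<n}. c ! (i - 1) < c ! i \<or> (c ! (i - 1) = c ! i \<and> \<sigma> i < \<sigma> (Suc i))"
  have "c ! (i - 1) < c ! (j - 1) \<or> (c ! (i - 1) = c ! (j - 1) \<and> \<sigma> i < \<sigma> j)"
    if "Suc i \<le> j" "1 \<le> i" "j \<le> n" for i j
    using that
  proof (induction j rule: dec_induct)
    case base
    then show ?case using adj by auto
  next
    case (step j)
    then have "j \<in> {1..<n}" by auto
    with adj have "c ! (j - 1) < c ! j \<or> (c ! (j - 1) = c ! j \<and> \<sigma> j < \<sigma> (Suc j))" by blast
    then show ?case using step by auto
  qed
  then show "compatible n \<sigma> c" unfolding compatible_def by auto
qed

text \<open>
  The entry \<open>s\<^sub>i\<close> encoded by the letter \<open>c\<^sub>i\<close>; the parity of \<open>c\<^sub>i\<close> tells whether \<open>i\<close> is an excedance.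
\<close>

definition letter_value :: "nat \<Rightarrow> nat \<Rightarrow> nat" where
  "letter_value M e = M - Suc (e div 2)"

lemma letter_less_iff:
  assumes "e < 2 * M" "e' < 2 * M"
  shows "e < e' \<or> (e = e' \<and> P) \<longleftrightarrow>
     letter_value M e' \<le> letter_value M e \<and>
     ((odd e \<and> even e') \<or> ((even e \<longleftrightarrow> even e') \<and> \<not> P) \<longrightarrow> letter_value M e' < letter_value M e)"
proof -
  define a a' where "a = e div 2" and "a' = e' div 2"
  have "a < M" "a' < M" using assms by (auto simp: a_def a'_def)
  then have v: "letter_value M e' \<le> letter_value M e \<longleftrightarrow> a \<le> a'"
      "letter_value M e' < letter_value M e \<longleftrightarrow> a < a'"
    unfolding letter_value_def a_def[symmetric] a'_def[symmetric] by auto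
  have "e = 2 * a + (if even e then 0 else 1)" "e' = 2 * a' + (if even e' then 0 else 1)"
    unfolding a_def a'_def by (auto elim: evenE oddE)
  then show ?thesis
    unfolding v by (cases "even e"; cases "even e'"; cases P) (simp_all, linarith+)
qed

text \<open>
  Two neighbouring letters of the same value may follow each other if the first is even and the
  second odd, or if they have the same parity and \<open>\<sigma>\<close> ascends. The excluded cases are exactly the
  descents of \<open>\<sigma>\<close> after lowering the excedance letters.
\<close>

lemma compatible_iff_descending:
  assumes \<sigma>: "\<sigma> permutes {1..n}" and c: "c \<in> words {..<2 * M} n"
    and parity: "\<forall>i\<in>{1..n}. even (c ! (i - 1)) \<longleftrightarrow> i < \<sigma> i"
  shows "compatible n \<sigma> c \<longleftrightarrow> descending (excedance_descents n \<sigma>) (map (letter_value M) c)"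
proof -
  have len: "length c = n" and bound: "\<And>i. i < n \<Longrightarrow> c ! i < 2 * M"
    using c by (auto simp: words_def dest!: nth_mem)
  let ?s = "map (letter_value M) c"
  have "(c ! (i - 1) < c ! i \<or> (c ! (i - 1) = c ! i \<and> \<sigma> i < \<sigma> (Suc i))) \<longleftrightarrow>
      ?s ! i \<le> ?s ! (i - 1) \<and> (i \<in> excedance_descents n \<sigma> \<longrightarrow> ?s ! i < ?s ! (i - 1))"
    if i: "i \<in> {1..<n}" for i
  proof -
    have ne: "\<sigma> i \<noteq> \<sigma> (Suc i)"
      using permutes_inj[OF \<sigma>] by (metis injD n_not_Suc_n)
    have b: "c ! (i - 1) < 2 * M" "c ! i < 2 * M"
      using bound[of "i - 1"] bound[of i] i by auto
    have "i \<in> {1..n}" "Suc i \<in> {1..n}" using i by auto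
    then have p: "even (c ! (i - 1)) \<longleftrightarrow> i < \<sigma> i" "even (c ! i) \<longleftrightarrow> Suc i < \<sigma> (Suc i)"
      using parity by (blast, metis diff_Suc_1)
    have ed: "i \<in> excedance_descents n \<sigma> \<longleftrightarrow> (odd (c ! (i - 1)) \<and> even (c ! i)) \<or>
        ((even (c ! (i - 1)) \<longleftrightarrow> even (c ! i)) \<and> \<not> \<sigma> i < \<sigma> (Suc i))"
      using i ne unfolding excedance_descents_def p by auto
    have s: "?s ! (i - 1) = letter_value M (c ! (i - 1))" "?s ! i = letter_value M (c ! i)"
      using i len by auto
    show ?thesis
      unfolding ed s by (rule letter_less_iff[OF b])
  qed
  moreover have "(\<forall>i. Suc i < n \<longrightarrow> P (Suc i)) \<longleftrightarrow> (\<forall>i\<in>{1..<n}. P i)" for P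
    by (metis One_nat_def Suc_le_D atLeastLessThan_iff le_add1 plus_1_eq_Suc)
  note this[of "\<lambda>i. ?s ! i \<le> ?s ! (i - 1) \<and> (i \<in> excedance_descents n \<sigma> \<longrightarrow> ?s ! i < ?s ! (i - 1))"]
  ultimately show ?thesis
    unfolding compatible_iff_adjacent descending_def by (simp add: len)
qed

lemma sum_compatible_words:
  fixes q t :: "'a::field"
  assumes q: "\<And>i. q ^ Suc i \<noteq> 1" and \<sigma>: "\<sigma> permutes {1..n}"
  shows "(\<Sum>c | c \<in> words {..<2 * M} n \<and> compatible n \<sigma> c \<and> (\<forall>i\<in>{1..n}. even (c ! (i - 1)) \<longleftrightarrow> i < \<sigma> i).
      prod_list (map (\<lambda>e. (if even e then t else 1) * q ^ letter_value M e) c))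
    = t ^ exc n \<sigma> * q ^ \<Sum>(excedance_descents n \<sigma>) * complete_geometric q n (M - card (excedance_descents n \<sigma>))"
proof -
  let ?parity = "\<lambda>c. \<forall>i\<in>{1..n}. even (c ! (i - 1)) \<longleftrightarrow> i < \<sigma> i"
  define letters where "letters s = map (\<lambda>i. 2 * (M - Suc (s ! (i - 1))) + (if i < \<sigma> i then 0 else 1)) [1..<Suc n]" for s
  have len_letters: "length (letters s) = n" for s by (simp add: letters_def)
  have nth_letters: "letters s ! (i - 1) = 2 * (M - Suc (s ! (i - 1))) + (if i < \<sigma> i then 0 else 1)"
    if "i \<in> {1..n}" for i s
    using that unfolding letters_def by (subst nth_map) (auto simp del: upt_Suc)
  have exc: "exc n \<sigma> = card {i \<in> {1..n}. i < \<sigma> i}"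
  proof -
    have "\<not> n < \<sigma> n" if "1 \<le> n"
      using permutes_in_image[OF \<sigma>, of n] that by auto
    then have "{i \<in> {1..<n}. i < \<sigma> i} = {i \<in> {1..n}. i < \<sigma> i}"
      by (auto simp: order_le_less)
    then show ?thesis by (simp add: exc_def)
  qed
  have "(\<Sum>c | c \<in> words {..<2 * M} n \<and> compatible n \<sigma> c \<and> ?parity c.
      prod_list (map (\<lambda>e. (if even e then t else 1) * q ^ letter_value M e) c)) =
    (\<Sum>s | s \<in> words {..<M} n \<and> descending (excedance_descents n \<sigma>) s.
      t ^ exc n \<sigma> * prod_list (map (\<lambda>x. q ^ x) s))"
  proof (rule sum.reindex_bij_witness[of _ letters "map (letter_value M)"])
    fix c assume "c \<in> {c. c \<in> words {..<2 * M} n \<and> compatible n \<sigma> c \<and> ?parity c}"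
    then have c: "c \<in> words {..<2 * M} n" "compatible n \<sigma> c" "?parity c" and len: "length c = n"
      and bound: "\<And>i. i < n \<Longrightarrow> c ! i < 2 * M"
      by (auto simp: words_def dest!: nth_mem)
    show "letters (map (letter_value M) c) = c"
    proof (rule list_eq_from_1[OF len_letters len])
      fix i assume i: "i \<in> {1..n}"
      have b: "c ! (i - 1) < 2 * M" and l: "i - 1 < length c" using i bound len by auto
      have p: "i < \<sigma> i \<longleftrightarrow> even (c ! (i - 1))" using c(3) i by blast
      show "letters (map (letter_value M) c) ! (i - 1) = c ! (i - 1)"
        unfolding nth_letters[OF i] p nth_map[OF l] letter_value_def using b by presburger
    qed
    have "set c \<subseteq> {..<2 * M}" using c by (simp add: words_def)
    then have "set (map (letter_value M) c) \<subseteq> {..<M}"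
      by (force simp: letter_value_def)
    then show "map (letter_value M) c \<in> {s. s \<in> words {..<M} n \<and> descending (excedance_descents n \<sigma>) s}"
      using compatible_iff_descending[OF \<sigma> c(1,3)] c(2) len by (simp add: words_def)
    have "(\<Prod>i\<in>{1..n}. if even (c ! (i - 1)) then t else 1) = (\<Prod>i\<in>{1..n}. if i < \<sigma> i then t else 1)"
      using c(3) by (intro prod.cong) auto
    also have "\<dots> = t ^ exc n \<sigma>"
      unfolding exc by (subst prod.inter_filter[symmetric]) simp_all
    finally show "t ^ exc n \<sigma> * prod_list (map (\<lambda>x. q ^ x) (map (letter_value M) c)) =
        prod_list (map (\<lambda>e. (if even e then t else 1) * q ^ letter_value M e) c)"
      by (simp only: map_map prod_list_map_positions[OF len] prod.distrib comp_def)
  next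
    fix s assume "s \<in> {s. s \<in> words {..<M} n \<and> descending (excedance_descents n \<sigma>) s}"
    then have s: "s \<in> words {..<M} n" "descending (excedance_descents n \<sigma>) s" and len: "length s = n"
      and bound: "\<And>i. i < n \<Longrightarrow> s ! i < M"
      by (auto simp: words_def dest!: nth_mem)
    show restore: "map (letter_value M) (letters s) = s"
    proof (rule list_eq_from_1[of _ n])
      fix i assume i: "i \<in> {1..n}"
      have b: "s ! (i - 1) < M" and l: "i - 1 < length (letters s)" using i bound len_letters by auto
      show "map (letter_value M) (letters s) ! (i - 1) = s ! (i - 1)"
        unfolding nth_map[OF l] nth_letters[OF i] letter_value_def using b by auto
    qed (simp_all add: len_letters len)
    have parity: "?parity (letters s)"
      by (intro ballI) (simp only: nth_letters, simp)
    have "letters s ! j < 2 * M" if "j < n" for j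
      using nth_letters[of "Suc j" s] bound[OF that] that by simp linarith
    then have w: "letters s \<in> words {..<2 * M} n"
      by (auto simp: words_def len_letters in_set_conv_nth)
    show "letters s \<in> {c. c \<in> words {..<2 * M} n \<and> compatible n \<sigma> c \<and> ?parity c}"
      using w parity compatible_iff_descending[OF \<sigma> w parity] s(2) restore by simp
  qed
  also have "\<dots> = t ^ exc n \<sigma> * (q ^ \<Sum>(excedance_descents n \<sigma> \<inter> {1..<n}) *
      complete_geometric q n (M - card (excedance_descents n \<sigma> \<inter> {1..<n})))"
    unfolding sum_distrib_left[symmetric] by (subst sum_descending[OF q]) rule
  also have "excedance_descents n \<sigma> \<inter> {1..<n} = excedance_descents n \<sigma>"
    by (auto simp: excedance_descents_def)
  finally show ?thesis by (simp only: mult.assoc)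
qed

lemma word_series_const:
  "word_series A (\<lambda>i j. fps_const (b i j)) = Abs_fps (\<lambda>n. \<Sum>w\<in>words A n. word_weight b w)"
proof -
  have const: "fps_const (\<Sum>x\<in>X. f x) = (\<Sum>x\<in>X. fps_const (f x))" for f :: "nat list \<Rightarrow> 'a" and X
    by (induction X rule: infinite_finite_induct) (simp_all flip: fps_const_add)
  have "prod_list (map (\<lambda>(i, j). fps_const (b i j)) xs) = fps_const (prod_list (map (\<lambda>(i, j). b i j) xs))" for xs
    by (induction xs) auto
  then have "word_weight (\<lambda>i j. fps_const (b i j)) w = fps_const (word_weight b w)" for w
    by (simp only: word_weight_def)
  then show ?thesis
    unfolding word_series_def fps_total_def
    by (intro fps_ext) (simp add: const[symmetric] if_distrib cong: if_cong)
qed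

text \<open>
  With \<open>E\<close> the product of the \<open>1 - q\<^sup>s z\<close> for \<open>s < M\<close> and \<open>E\<^sub>t\<close> the same product at \<open>t z\<close>, all words with
  the threshold conditions contribute \<open>F = (1 - t) / (E - t E\<^sub>t)\<close>. Excluding even letters that head
  their blocks multiplies this by \<open>E\<^sub>t\<close>. The two series in the identity besides the left-hand
  factor are the inverses of \<open>E\<close> and \<open>E\<^sub>t\<close>.
\<close>

lemma bounded_identity:
  fixes q t :: "'a::field"
  assumes q: "\<And>i. q ^ Suc i \<noteq> 1"
  shows "Abs_fps (\<lambda>n. \<Sum>\<sigma> | \<sigma> permutes {1..n}. t ^ exc n \<sigma> * q ^ \<Sum>(excedance_descents n \<sigma>) *
        complete_geometric q n (M - card (excedance_descents n \<sigma>))) *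
      (Abs_fps (\<lambda>n. t ^ n * complete_geometric q n M) - fps_const t * Abs_fps (\<lambda>n. complete_geometric q n M)) =
      fps_const (1 - t) * Abs_fps (\<lambda>n. complete_geometric q n M)"
    (is "?G * (?Ht - _ * ?H) = _")
proof -
  define wt where "wt e = (if even e then t else 1) * q ^ letter_value M e" for e
  define b where "b i j = (if within_threshold i j then wt i else 0)" for i j
  define x where "x j = q ^ (M - Suc j)" for j
  define E where "E = (\<Prod>s<M. 1 - fps_const (q ^ s) * fps_X)"
  define Et where "Et = (\<Prod>s<M. 1 - fps_const (t * q ^ s) * fps_X)"
  define F where "F = word_series {..<2 * M} (threshold_matrix t x 0)"
  have E: "(\<Prod>j<M. 1 - fps_const (x j) * fps_X) = E"
    unfolding x_def E_def by (rule prod.nat_diff_reindex)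
  have Et: "(\<Prod>j<M. 1 - fps_const (t * x j) * fps_X) = Et"
    unfolding x_def Et_def by (rule prod.nat_diff_reindex)
  have H: "?H * E = 1" and Ht: "?Ht * Et = 1"
    using complete_geometric_series[OF q, where c = 1 and N = M]
      complete_geometric_series[OF q, where c = t and N = M] by (simp_all add: E_def Et_def)
  have F: "F * (E - fps_const t * Et) = fps_const (1 - t)"
    using word_series_threshold[of M t x 0] by (simp add: F_def E Et)
  have "threshold_matrix t x 0 = (\<lambda>i j. fps_const (b i j))"
    by (auto simp: fun_eq_iff threshold_matrix_def b_def wt_def within_threshold_def x_def letter_value_def)
  then have words: "Abs_fps (\<lambda>n. \<Sum>w\<in>words {..<2 * M} n. word_weight b w) = F"
    unfolding F_def by (simp only: word_series_const)
  have "?G = Abs_fps (\<lambda>n. \<Sum>w\<in>headless_words {e \<in> {..<2 * M}. even e} {..<2 * M} n. word_weight b w)"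
    unfolding b_def headless_words_permutations[OF finite_lessThan] wt_def
    by (intro arg_cong[where f = Abs_fps] ext sum.cong refl)
       (simp only: sum_compatible_words[OF q] mem_Collect_eq)
  also have "\<dots> = (\<Prod>i\<in>{e \<in> {..<2 * M}. even e}. 1 - fps_const (b i i) * fps_X) * F"
    unfolding words[symmetric] by (rule headless_words_series) auto
  also have "(\<Prod>i\<in>{e \<in> {..<2 * M}. even e}. 1 - fps_const (b i i) * fps_X) =
      (\<Prod>j<M. 1 - fps_const (t * x j) * fps_X)"
    by (rule prod.reindex_bij_witness[of _ "\<lambda>j. 2 * j" "\<lambda>e. e div 2"])
       (auto simp: b_def within_threshold_def wt_def letter_value_def x_def)
  finally have G: "?G = Et * F" by (simp only: Et)
  have "?G * (?Ht - fps_const t * ?H) = F * (?Ht * Et) - fps_const t * ?H * Et * F"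
    unfolding G by (simp add: algebra_simps)
  also have "\<dots> = F * (?H * E) - fps_const t * ?H * Et * F"
    by (simp only: H Ht)
  also have "\<dots> = (F * (E - fps_const t * Et)) * ?H"
    by (simp only: right_diff_distrib left_diff_distrib mult_ac)
  finally show ?thesis by (simp only: F)
qed

section \<open>The identity for the joint distribution\<close>

text \<open>
  Each coefficient of \<open>bounded_identity\<close> is an equation between eventual polynomials in \<open>q\<^sup>M\<close>;
  comparing constant terms removes the bound \<open>M\<close>.
\<close>

lemma excedance_identity:
  fixes q t :: "'a::field"
  assumes inj: "inj (\<lambda>N. q ^ N)"
  defines "P n \<equiv> \<Prod>i<n. 1 - q ^ Suc i"
  shows "Abs_fps (\<lambda>n. (\<Sum>\<sigma> | \<sigma> permutes {1..n}. t ^ exc n \<sigma> * q ^ \<Sum>(excedance_descents n \<sigma>)) / P n) *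
      (Abs_fps (\<lambda>n. t ^ n / P n) - fps_const t * Abs_fps (\<lambda>n. 1 / P n)) =
      fps_const (1 - t) * Abs_fps (\<lambda>n. 1 / P n)"
proof (rule fps_ext)
  fix n
  have q: "q ^ Suc i \<noteq> 1" for i
    using inj_eq[OF inj, of "Suc i" 0] by simp
  have q0: "q \<noteq> 0"
    using inj_eq[OF inj, of 1 2] by auto
  note lim = power_limit_complete_geometric[OF q0, folded P_def]
  have lim0: "power_limit q (\<lambda>M. complete_geometric q k M) (1 / P k)" for k
    using lim[of k 0] by simp
  let ?G = "\<lambda>k M. \<Sum>\<sigma> | \<sigma> permutes {1..k}. t ^ exc k \<sigma> * q ^ \<Sum>(excedance_descents k \<sigma>) *
        complete_geometric q k (M - card (excedance_descents k \<sigma>))"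
  have "power_limit q (\<lambda>M. \<Sum>k\<le>n. ?G k M * ((t ^ (n - k) - t) * complete_geometric q (n - k) M))
      (\<Sum>k\<le>n. (\<Sum>\<sigma> | \<sigma> permutes {1..k}. t ^ exc k \<sigma> * q ^ \<Sum>(excedance_descents k \<sigma>) * (1 / P k)) *
         ((t ^ (n - k) - t) * (1 / P (n - k))))"
    by (intro power_limit_sum power_limit_mult power_limit_const lim lim0)
  moreover have "(\<Sum>k\<le>n. ?G k M * ((t ^ (n - k) - t) * complete_geometric q (n - k) M)) =
      (1 - t) * complete_geometric q n M" for M
    using arg_cong[OF bounded_identity[OF q, where t = t and M = M], of "\<lambda>f. f $ n"]
    by (simp add: fps_mult_nth[of "Abs_fps f" for f] atLeast0AtMost left_diff_distrib)
  ultimately have "power_limit q (\<lambda>M. (1 - t) * complete_geometric q n M)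
      (\<Sum>k\<le>n. (\<Sum>\<sigma> | \<sigma> permutes {1..k}. t ^ exc k \<sigma> * q ^ \<Sum>(excedance_descents k \<sigma>) * (1 / P k)) *
         ((t ^ (n - k) - t) * (1 / P (n - k))))"
    by simp
  moreover have "power_limit q (\<lambda>M. (1 - t) * complete_geometric q n M) ((1 - t) * (1 / P n))"
    by (intro power_limit_mult power_limit_const lim0)
  ultimately have "(\<Sum>k\<le>n. (\<Sum>\<sigma> | \<sigma> permutes {1..k}. t ^ exc k \<sigma> * q ^ \<Sum>(excedance_descents k \<sigma>) * (1 / P k)) *
         ((t ^ (n - k) - t) * (1 / P (n - k)))) = (1 - t) * (1 / P n)"
    by (rule power_limit_unique[OF inj])
  then show "(Abs_fps (\<lambda>n. (\<Sum>\<sigma> | \<sigma> permutes {1..n}. t ^ exc n \<sigma> * q ^ \<Sum>(excedance_descents n \<sigma>)) / P n) *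
      (Abs_fps (\<lambda>n. t ^ n / P n) - fps_const t * Abs_fps (\<lambda>n. 1 / P n))) $ n =
      (fps_const (1 - t) * Abs_fps (\<lambda>n. 1 / P n)) $ n"
    by (simp add: fps_mult_nth[of "Abs_fps f" for f] atLeast0AtMost sum_divide_distrib diff_divide_distrib left_diff_distrib)
qed

lemma prod_one_minus_power:
  fixes q :: "'a::comm_ring_1"
  shows "(\<Prod>i<n. 1 - q ^ Suc i) = (1 - q) ^ n * q_fact q n"
proof -
  have "(\<Prod>i<n. 1 - q ^ Suc i) = (\<Prod>i<n. (1 - q) * q_int q (Suc i))"
    unfolding q_int_def by (intro prod.cong refl) (rule one_diff_power_eq)
  also have "\<dots> = (1 - q) ^ n * q_fact q n"
    unfolding q_fact_def by (simp add: prod.distrib prod.atLeast1_atMost_eq)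
  finally show ?thesis .
qed

text \<open>
  The previous identity with \<open>t q\<close> in place of \<open>t\<close>. The product \<open>(1 - q)\<dots>(1 - q\<^sup>n)\<close> is
  \<open>(1 - q)\<^sup>n\<close> times the \<open>q\<close>-factorial, so the substitution of \<open>(1 - q) z\<close> for \<open>z\<close> turns one into the
  other.
\<close>

lemma maj_exc_identity:
  fixes q t :: "'a::field"
  assumes inj: "inj (\<lambda>N. q ^ N)"
  shows "Abs_fps (\<lambda>n. A_maj_exc n q t / q_fact q n) *
      ((exp_q q oo (fps_const (t * q) * fps_X)) - fps_const (t * q) * exp_q q) =
      fps_const (1 - t * q) * exp_q q"
proof -
  let ?P = "\<lambda>n. \<Prod>i<n. 1 - q ^ Suc i"
  have q1: "1 - q \<noteq> 0"
    using inj_eq[OF inj, of 1 0] by auto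
  have A: "(\<Sum>\<sigma> | \<sigma> permutes {1..n}. (t * q) ^ exc n \<sigma> * q ^ \<Sum>(excedance_descents n \<sigma>)) = A_maj_exc n q t" for n
    unfolding A_maj_exc_def
    by (intro sum.cong refl)
       (simp add: sum_excedance_descents[symmetric] power_add power_mult_distrib mult_ac)
  have rescale: "Abs_fps (\<lambda>n. f n / ?P n) oo (fps_const (1 - q) * fps_X) = Abs_fps (\<lambda>n. f n / q_fact q n)" for f
    unfolding fps_compose_linear prod_one_minus_power using q1 by simp
  have c0: "(fps_const (1 - q) * fps_X) $ 0 = 0"
    by simp
  have "(Abs_fps (\<lambda>n. A_maj_exc n q t / ?P n) *
      (Abs_fps (\<lambda>n. (t * q) ^ n / ?P n) - fps_const (t * q) * Abs_fps (\<lambda>n. 1 / ?P n)))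
        oo (fps_const (1 - q) * fps_X) =
      (fps_const (1 - t * q) * Abs_fps (\<lambda>n. 1 / ?P n)) oo (fps_const (1 - q) * fps_X)"
    using excedance_identity[OF inj, of "t * q"] unfolding A by (rule arg_cong)
  then have "Abs_fps (\<lambda>n. A_maj_exc n q t / q_fact q n) *
      (Abs_fps (\<lambda>n. (t * q) ^ n / q_fact q n) - fps_const (t * q) * Abs_fps (\<lambda>n. 1 / q_fact q n)) =
      fps_const (1 - t * q) * Abs_fps (\<lambda>n. 1 / q_fact q n)"
    by (simp only: fps_compose_mult_distrib[OF c0] fps_compose_sub_distrib fps_const_compose rescale)
  moreover have "exp_q q oo (fps_const (t * q) * fps_X) = Abs_fps (\<lambda>n. (t * q) ^ n / q_fact q n)"
    unfolding fps_compose_linear by (simp add: exp_q_def)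
  ultimately show ?thesis by (simp add: exp_q_def)
qed

lemma inj_power_var_q: "inj (\<lambda>N. var_q ^ N)"
proof (rule injI)
  fix m n assume "var_q ^ m = var_q ^ n"
  then have "([:[:0, 1:]:] :: int poly poly) ^ m = [:[:0, 1:]:] ^ n"
    unfolding var_q_def to_fract_power[symmetric] to_fract_eq_iff .
  then have "poly (poly ([:[:0, 1:]:] ^ m) 0) (2::int) = poly (poly ([:[:0, 1:]:] ^ n) 0) 2"
    by simp
  then have "(2::int) ^ m = 2 ^ n" by (simp add: poly_power)
  then show "m = n" by simp
qed

lemma var_t_times_var_q_neq_1: "var_t * var_q \<noteq> 1"
proof -
  have "var_t * var_q = to_fract [:0, [:0, 1:]:]"
    by (simp add: var_t_def var_q_def flip: to_fract_mult)
  also have "\<dots> \<noteq> to_fract 1"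
    by (simp only: to_fract_eq_iff) (simp add: one_pCons)
  finally show ?thesis by simp
qed

theorem theorem1p1:
  fixes q t :: ratfun_qt
  defines "q \<equiv> var_q" and "t \<equiv> var_t"
  shows "Abs_fps (\<lambda>n. A_maj_exc n q t / q_fact q n) =
           (fps_const (1 - t * q) * exp_q q) /
           ((exp_q q oo (fps_const (t * q) * fps_X)) - fps_const (t * q) * exp_q q)"
    (is "?A = ?num / ?den")
proof -
  have "?den $ 0 = 1 - t * q"
    by (simp add: exp_q_def q_fact_def)
  moreover have "t * q \<noteq> 1"
    unfolding q_def t_def by (rule var_t_times_var_q_neq_1)
  ultimately have "?den $ 0 \<noteq> 0"
    by (simp only: right_minus_eq)
  then have "?den \<noteq> 0"
    by (rule contrapos_nn) (simp only: fps_zero_nth)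
  then have "?A = (?A * ?den) / ?den"
    by (rule nonzero_mult_div_cancel_right[symmetric])
  also have "?A * ?den = ?num"
    unfolding q_def by (rule maj_exc_identity[OF inj_power_var_q])
  finally show ?thesis .
qed

end
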